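(* For an Archimedean vector lattice $X$ the following statements are equivalent. (i) $X$ is lattice isomorphic to $c_{00}(\Lambda)$ for some non-empty index set $\Lambda$. (ii) $\mathscr L(X,Y)=\mathscr L_n(X,Y)$ for every Archimedean vector lattice $Y$. (iii) $\mathscr L(X,Y)=\mathscr L_b(X,Y)$ for every Archimedean vector lattice $Y$. (iv) $X^\sim=X'$.
   Context: Vector lattices are real. $c_{00}(\Lambda)$ is the vector lattice of all finitely supported real functions on $\Lambda$ with pointwise order. $\mathscr L(X,Y)$, $\mathscr L_b(X,Y)$, $\mathscr L_n(X,Y)$ denote the spaces of all linear operators, all order bounded linear operators (mapping order bounded sets to order bounded sets, where a set is order bounded if it is contained in some order interval), and all order continuous linear operators from $X$ to $Y$, respectively; $X'=\mathscr L(X,\mathbb R)$ and $X^\sim=\mathscr L_b(X,\mathbb R)$. A net $(x_\alpha)$ converges in order to $x$ if there is a net $(y_\beta)$ with $y_\beta\searrow 0$ such that for every $\beta$ there is $\alpha_0$ with $|x_\alpha-x|\le y_\beta$ for all $\alpha\ge\alpha_0$; a linear operator is order continuous if it maps nets converging in order to $0$ to nets converging in order to $0$.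
   Formalization: X is assumed non-zero, since for X = {0} statements (ii)–(iv) hold but (i) fails as Λ is non-empty; Y and Λ range over an arbitrary universe large enough to contain X, which up to isomorphism covers all Y and Λ. *)

theory Defs
  imports Complex_Main "HOL-Algebra.Module" "HOL-Algebra.Lattice"
begin

section \<open>Vector lattices with explicit carriers\<close>

text \<open>
  The theorem quantifies over all Archimedean vector lattices \<open>Y\<close> inside a formula, so vector
  lattices are structures with a carrier set rather than types. A real vector space is a
  HOL-Algebra module over the ring of reals; as always for such modules, the fields \<open>mult\<close> and
  \<open>one\<close> of the record are ignored.

  In the theorem, the lattices \<open>Y\<close> and the index sets \<open>\<Lambda>\<close> live in a type \<open>'u\<close> into which the carrier
  of \<open>X\<close> embeds. It plays the role of the universe of sets: \<open>'u\<close> is arbitrarily large, and the embedding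
  guarantees that it has room for the scalars (as \<open>X\<close> is not zero) and for every \<open>\<Lambda>\<close> that can
  occur, since \<open>c00 \<Lambda>\<close> contains a copy of \<open>\<Lambda>\<close>.
\<close>

record 'a vlat = "(real, 'a) module" +
  vle :: "'a \<Rightarrow> 'a \<Rightarrow> bool"

definition vorder :: "('a, 'm) vlat_scheme \<Rightarrow> 'a gorder" where
  "vorder X = \<lparr>carrier = carrier X, eq = (=), le = vle X\<rparr>"

definition real_ring :: "real ring" where
  "real_ring = \<lparr>carrier = UNIV, mult = (*), one = 1, zero = 0, add = (+)\<rparr>"

lemma cring_real_ring: "cring real_ring"
proof (rule cringI)
  show "abelian_group real_ring"
    by (rule abelian_groupI) (auto simp: real_ring_def intro: exI[of _ "- _"])
  show "comm_monoid real_ring"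
    by (rule comm_monoidI) (auto simp: real_ring_def)
qed (auto simp: real_ring_def algebra_simps)

locale vector_lattice = module real_ring X + order: Lattice.lattice "vorder X"
  for X :: "('a, 'm) vlat_scheme" (structure) +
  assumes add_mono: "\<lbrakk>x \<in> carrier X; y \<in> carrier X; z \<in> carrier X; x \<sqsubseteq>\<^bsub>vorder X\<^esub> y\<rbrakk>
      \<Longrightarrow> x \<oplus> z \<sqsubseteq>\<^bsub>vorder X\<^esub> y \<oplus> z"
    and smult_nonneg: "\<lbrakk>0 \<le> a; x \<in> carrier X; \<zero> \<sqsubseteq>\<^bsub>vorder X\<^esub> x\<rbrakk> \<Longrightarrow> \<zero> \<sqsubseteq>\<^bsub>vorder X\<^esub> a \<odot> x"

locale archimedean_vector_lattice = vector_lattice +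
  assumes archimedean: "\<lbrakk>x \<in> carrier X; y \<in> carrier X; \<zero> \<sqsubseteq>\<^bsub>vorder X\<^esub> x;
      \<And>n::nat. real n \<odot> x \<sqsubseteq>\<^bsub>vorder X\<^esub> y\<rbrakk> \<Longrightarrow> x = \<zero>"

definition modulus :: "('a, 'm) vlat_scheme \<Rightarrow> 'a \<Rightarrow> 'a" where
  "modulus X x = x \<squnion>\<^bsub>vorder X\<^esub> (\<ominus>\<^bsub>X\<^esub> x)"

definition real_vlat :: "real vlat" where
  "real_vlat = \<lparr>carrier = UNIV, mult = (*), one = 1, zero = 0, add = (+), smult = (*), vle = (\<le>)\<rparr>"

text \<open>Real functions on \<open>\<Lambda>\<close> are represented by functions that vanish outside \<open>\<Lambda>\<close>.\<close>

definition c00 :: "'i set \<Rightarrow> ('i \<Rightarrow> real) vlat" where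
  "c00 \<Lambda> = \<lparr>carrier = {f. (\<forall>i. i \<notin> \<Lambda> \<longrightarrow> f i = 0) \<and> finite {i. f i \<noteq> 0}},
     mult = (\<lambda>f g i. f i * g i), one = (\<lambda>i. 1),
     zero = (\<lambda>i. 0), add = (\<lambda>f g i. f i + g i),
     smult = (\<lambda>a f i. a * f i), vle = (\<lambda>f g. \<forall>i\<in>\<Lambda>. f i \<le> g i)\<rparr>"


section \<open>Linear operators\<close>

text \<open>Operators are extensional, so that a set of operators is a set of maps on the carrier.\<close>

definition linear_ops :: "('a, 'm) vlat_scheme \<Rightarrow> ('b, 'n) vlat_scheme \<Rightarrow> ('a \<Rightarrow> 'b) set" where
  "linear_ops X Y = {T \<in> carrier X \<rightarrow>\<^sub>E carrier Y.
     (\<forall>x\<in>carrier X. \<forall>y\<in>carrier X. T (x \<oplus>\<^bsub>X\<^esub> y) = T x \<oplus>\<^bsub>Y\<^esub> T y) \<and>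
     (\<forall>a. \<forall>x\<in>carrier X. T (a \<odot>\<^bsub>X\<^esub> x) = a \<odot>\<^bsub>Y\<^esub> T x)}"

definition lattice_isomorphic :: "('a, 'm) vlat_scheme \<Rightarrow> ('b, 'n) vlat_scheme \<Rightarrow> bool" where
  "lattice_isomorphic X Y \<longleftrightarrow> (\<exists>T\<in>linear_ops X Y. bij_betw T (carrier X) (carrier Y) \<and>
     (\<forall>x\<in>carrier X. \<forall>y\<in>carrier X.
        T (x \<squnion>\<^bsub>vorder X\<^esub> y) = T x \<squnion>\<^bsub>vorder Y\<^esub> T y \<and>
        T (x \<sqinter>\<^bsub>vorder X\<^esub> y) = T x \<sqinter>\<^bsub>vorder Y\<^esub> T y))"

definition order_bounded :: "('a, 'm) vlat_scheme \<Rightarrow> 'a set \<Rightarrow> bool" where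
  "order_bounded X A \<longleftrightarrow> (\<exists>l\<in>carrier X. \<exists>u\<in>carrier X. A \<subseteq> \<lbrace>l..u\<rbrace>\<^bsub>vorder X\<^esub>)"

definition order_bounded_ops :: "('a, 'm) vlat_scheme \<Rightarrow> ('b, 'n) vlat_scheme \<Rightarrow> ('a \<Rightarrow> 'b) set" where
  "order_bounded_ops X Y =
     {T \<in> linear_ops X Y. \<forall>A. order_bounded X A \<longrightarrow> order_bounded Y (T ` A)}"

abbreviation algebraic_dual :: "('a, 'm) vlat_scheme \<Rightarrow> ('a \<Rightarrow> real) set" where
  "algebraic_dual X \<equiv> linear_ops X real_vlat"

abbreviation order_dual :: "('a, 'm) vlat_scheme \<Rightarrow> ('a \<Rightarrow> real) set" where
  "order_dual X \<equiv> order_bounded_ops X real_vlat"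


section \<open>Order convergence of nets\<close>

text \<open>A net is a map on a set \<open>I\<close> that is directed by a preorder \<open>r\<close>; \<open>(i, j) \<in> r\<close> means \<open>i \<le> j\<close>.\<close>

definition directed_by :: "'i set \<Rightarrow> 'i rel \<Rightarrow> bool" where
  "directed_by I r \<longleftrightarrow> I \<noteq> {} \<and> preorder_on I r \<and>
     (\<forall>i\<in>I. \<forall>j\<in>I. \<exists>k\<in>I. (i, k) \<in> r \<and> (j, k) \<in> r)"

definition decreases_to_zero :: "('a, 'm) vlat_scheme \<Rightarrow> 'j set \<Rightarrow> 'j rel \<Rightarrow> ('j \<Rightarrow> 'a) \<Rightarrow> bool" where
  "decreases_to_zero X J s y \<longleftrightarrow> directed_by J s \<and> y \<in> J \<rightarrow> carrier X \<and>
     (\<forall>i\<in>J. \<forall>j\<in>J. (i, j) \<in> s \<longrightarrow> y j \<sqsubseteq>\<^bsub>vorder X\<^esub> y i) \<and>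
     is_glb (vorder X) \<zero>\<^bsub>X\<^esub> (y ` J)"

definition dominated_by ::
  "('a, 'm) vlat_scheme \<Rightarrow> 'i set \<Rightarrow> 'i rel \<Rightarrow> ('i \<Rightarrow> 'a) \<Rightarrow> 'a \<Rightarrow> 'j set \<Rightarrow> ('j \<Rightarrow> 'a) \<Rightarrow> bool" where
  "dominated_by X I r x l J y \<longleftrightarrow> (\<forall>\<beta>\<in>J. \<exists>\<alpha>\<^sub>0\<in>I. \<forall>\<alpha>\<in>I. (\<alpha>\<^sub>0, \<alpha>) \<in> r \<longrightarrow>
     modulus X (x \<alpha> \<ominus>\<^bsub>X\<^esub> l) \<sqsubseteq>\<^bsub>vorder X\<^esub> y \<beta>)"

text \<open>
  A definition cannot quantify over all index types. The two index types chosen below, \<open>'a\<close> for the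
  dominating net and \<open>'a \<times> 'a\<close> for the nets that test order continuity, lose nothing:
  see \<open>order_convergesI\<close> and \<open>order_continuousD\<close>, which hold for nets over arbitrary index types.
\<close>

definition order_converges ::
  "('a, 'm) vlat_scheme \<Rightarrow> 'i set \<Rightarrow> 'i rel \<Rightarrow> ('i \<Rightarrow> 'a) \<Rightarrow> 'a \<Rightarrow> bool" where
  "order_converges X I r x l \<longleftrightarrow> directed_by I r \<and> x \<in> I \<rightarrow> carrier X \<and> l \<in> carrier X \<and>
     (\<exists>(J::'a set) s y. decreases_to_zero X J s y \<and> dominated_by X I r x l J y)"

definition order_continuous :: "('a, 'm) vlat_scheme \<Rightarrow> ('b, 'n) vlat_scheme \<Rightarrow> ('a \<Rightarrow> 'b) \<Rightarrow> bool" where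
  "order_continuous X Y T \<longleftrightarrow> (\<forall>(I::('a \<times> 'a) set) r x.
     order_converges X I r x \<zero>\<^bsub>X\<^esub> \<longrightarrow> order_converges Y I r (\<lambda>i. T (x i)) \<zero>\<^bsub>Y\<^esub>)"

definition order_continuous_ops :: "('a, 'm) vlat_scheme \<Rightarrow> ('b, 'n) vlat_scheme \<Rightarrow> ('a \<Rightarrow> 'b) set" where
  "order_continuous_ops X Y = {T \<in> linear_ops X Y. order_continuous X Y T}"

lemma order_convergesI:
  fixes X :: "('a, 'm) vlat_scheme" and J :: "'j set"
  assumes X: "vector_lattice X" and I: "directed_by I r" and x: "x \<in> I \<rightarrow> carrier X"
    and l: "l \<in> carrier X"
    and y: "decreases_to_zero X J s y" and d: "dominated_by X I r x l J y"
  shows "order_converges X I r x l"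
proof -
  interpret vector_lattice X by (rule X)
  define J' where "J' = y ` J"
  define s' where "s' = {(u, v). u \<in> J' \<and> v \<in> J' \<and> vle X v u}"
  have sub: "J' \<subseteq> carrier X" using y by (auto simp: J'_def decreases_to_zero_def)
  have refl: "vle X u u" if "u \<in> carrier X" for u
    using order.le_refl[of u] that by (simp add: vorder_def)
  have trans: "vle X u w" if "vle X u v" "vle X v w" "u \<in> carrier X" "v \<in> carrier X" "w \<in> carrier X" for u v w
    using order.le_trans[of u v w] that by (simp add: vorder_def)
  have "directed_by J' s'"
    unfolding directed_by_def
  proof (intro conjI ballI)
    show "J' \<noteq> {}" using y by (auto simp: J'_def decreases_to_zero_def directed_by_def)
    show "preorder_on J' s'"
      unfolding preorder_on_def refl_on_def trans_def s'_def
      using refl trans sub by blast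
    fix u v assume "u \<in> J'" "v \<in> J'"
    then obtain i j where ij: "i \<in> J" "j \<in> J" "u = y i" "v = y j" by (auto simp: J'_def)
    then obtain k where "k \<in> J" "(i, k) \<in> s" "(j, k) \<in> s"
      using y unfolding decreases_to_zero_def directed_by_def by blast
    then show "\<exists>w\<in>J'. (u, w) \<in> s' \<and> (v, w) \<in> s'"
      using ij y by (auto simp: s'_def J'_def decreases_to_zero_def vorder_def intro!: bexI[of _ "y k"])
  qed
  then have "decreases_to_zero X J' s' (\<lambda>u. u)"
    using y sub by (auto simp: decreases_to_zero_def s'_def J'_def vorder_def)
  moreover have "dominated_by X I r x l J' (\<lambda>u. u)"
    using d by (auto simp: dominated_by_def J'_def)
  ultimately show ?thesis
    using I x l unfolding order_converges_def by blast
qed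

lemma order_continuousD:
  fixes X :: "('a, 'm) vlat_scheme" and Y :: "('b, 'n) vlat_scheme" and I :: "'i set"
  assumes X: "vector_lattice X" and T: "order_continuous X Y T" "T \<in> carrier X \<rightarrow> carrier Y"
    and x: "order_converges X I r x \<zero>\<^bsub>X\<^esub>"
  shows "order_converges Y I r (\<lambda>i. T (x i)) \<zero>\<^bsub>Y\<^esub>"
proof -
  interpret vector_lattice X by (rule X)
  obtain J :: "'a set" and s y where y: "decreases_to_zero X J s y"
    and d: "dominated_by X I r x \<zero>\<^bsub>X\<^esub> J y"
    using x by (auto simp: order_converges_def)
  have I: "directed_by I r" and xI: "x \<in> I \<rightarrow> carrier X" and z: "\<zero>\<^bsub>X\<^esub> \<in> carrier X"
    using x by (auto simp: order_converges_def)
  have yJ: "y \<in> J \<rightarrow> carrier X" and J: "directed_by J s"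
    and mono: "\<And>i j. i \<in> J \<Longrightarrow> j \<in> J \<Longrightarrow> (i, j) \<in> s \<Longrightarrow> vle X (y j) (y i)"
    using y by (auto simp: decreases_to_zero_def vorder_def)
  have refl: "vle X u u" if "u \<in> carrier X" for u
    using order.le_refl[of u] that by (simp add: vorder_def)
  have trans: "vle X u w" if "vle X u v" "vle X v w" "u \<in> carrier X" "v \<in> carrier X" "w \<in> carrier X" for u v w
    using order.le_trans[of u v w] that by (simp add: vorder_def)
  have mod: "modulus X v \<in> carrier X" if "v \<in> carrier X" for v
    using order.join_closed[of v "\<ominus>\<^bsub>X\<^esub> v"] that by (simp add: modulus_def vorder_def)
  define I' where "I' = {(u, v). u \<in> y ` J \<and> v \<in> carrier X \<and> vle X (modulus X (v \<ominus>\<^bsub>X\<^esub> \<zero>\<^bsub>X\<^esub>)) u}"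
  define r' where "r' = {(p, q). p \<in> I' \<and> q \<in> I' \<and> vle X (fst q) (fst p)}"
  have tail: "\<exists>\<alpha>\<^sub>0\<in>I. \<forall>\<alpha>\<in>I. (\<alpha>\<^sub>0, \<alpha>) \<in> r \<longrightarrow> (y j, x \<alpha>) \<in> I'" if "j \<in> J" for j
    using d that xI unfolding dominated_by_def I'_def vorder_def by fastforce
  have ne: "\<exists>v. (y j, v) \<in> I'" if j: "j \<in> J" for j
  proof -
    obtain a where "a \<in> I" "\<forall>\<alpha>\<in>I. (a, \<alpha>) \<in> r \<longrightarrow> (y j, x \<alpha>) \<in> I'" using tail[OF j] by blast
    moreover have "(a, a) \<in> r" using I \<open>a \<in> I\<close> by (auto simp: directed_by_def preorder_on_def refl_on_def)
    ultimately show ?thesis by blast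
  qed
  have fstI: "fst p \<in> y ` J" "fst p \<in> carrier X" if "p \<in> I'" for p
    using that yJ by (auto simp: I'_def)
  have I': "directed_by I' r'"
    unfolding directed_by_def
  proof (intro conjI ballI)
    show "I' \<noteq> {}" using J ne by (fastforce simp: directed_by_def)
    show "preorder_on I' r'"
      unfolding preorder_on_def refl_on_def trans_def r'_def
      using refl trans fstI by blast
    fix p q assume pq: "p \<in> I'" "q \<in> I'"
    then obtain i j where ij: "i \<in> J" "j \<in> J" "fst p = y i" "fst q = y j" using fstI by (metis imageE)
    then obtain k where k: "k \<in> J" "(i, k) \<in> s" "(j, k) \<in> s"
      using J unfolding directed_by_def by blast
    obtain v where "(y k, v) \<in> I'" using ne k by blast
    then show "\<exists>w\<in>I'. (p, w) \<in> r' \<and> (q, w) \<in> r'"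
      using pq ij k mono by (auto simp: r'_def intro!: bexI[of _ "(y k, v)"])
  qed
  have "dominated_by X I' r' snd \<zero>\<^bsub>X\<^esub> J y"
    unfolding dominated_by_def
  proof
    fix j assume j: "j \<in> J"
    obtain v where v: "(y j, v) \<in> I'" using ne j by blast
    have "vle X (modulus X (snd q \<ominus>\<^bsub>X\<^esub> \<zero>\<^bsub>X\<^esub>)) (y j)" if "q \<in> I'" "((y j, v), q) \<in> r'" for q
    proof (rule trans)
      show "vle X (modulus X (snd q \<ominus>\<^bsub>X\<^esub> \<zero>\<^bsub>X\<^esub>)) (fst q)" "vle X (fst q) (y j)"
        using that by (auto simp: r'_def I'_def)
      show "fst q \<in> carrier X" using fstI that by blast
      show "y j \<in> carrier X" using yJ j by blast
      have "snd q \<in> carrier X" using that by (auto simp: I'_def)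
      then show "modulus X (snd q \<ominus>\<^bsub>X\<^esub> \<zero>\<^bsub>X\<^esub>) \<in> carrier X" using z by (intro mod) auto
    qed
    then show "\<exists>\<alpha>\<^sub>0\<in>I'. \<forall>\<alpha>\<in>I'. (\<alpha>\<^sub>0, \<alpha>) \<in> r' \<longrightarrow>
        modulus X (snd \<alpha> \<ominus>\<^bsub>X\<^esub> \<zero>\<^bsub>X\<^esub>) \<sqsubseteq>\<^bsub>vorder X\<^esub> y j"
      using v by (intro bexI[of _ "(y j, v)"]) (auto simp: vorder_def)
  qed
  moreover have "snd \<in> I' \<rightarrow> carrier X" by (auto simp: I'_def)
  ultimately have "order_converges X I' r' snd \<zero>\<^bsub>X\<^esub>"
    using I' z y unfolding order_converges_def by blast
  then have conv: "order_converges Y I' r' (\<lambda>i. T (snd i)) \<zero>\<^bsub>Y\<^esub>"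
    using T(1) by (simp add: order_continuous_def)
  then obtain K :: "'b set" and t w where w: "decreases_to_zero Y K t w"
    and dw: "dominated_by Y I' r' (\<lambda>i. T (snd i)) \<zero>\<^bsub>Y\<^esub> K w" and zY: "\<zero>\<^bsub>Y\<^esub> \<in> carrier Y"
    by (auto simp: order_converges_def)
  have "dominated_by Y I r (\<lambda>i. T (x i)) \<zero>\<^bsub>Y\<^esub> K w"
    unfolding dominated_by_def
  proof
    fix k assume "k \<in> K"
    then obtain p where p: "p \<in> I'" "\<forall>q\<in>I'. (p, q) \<in> r' \<longrightarrow>
        modulus Y (T (snd q) \<ominus>\<^bsub>Y\<^esub> \<zero>\<^bsub>Y\<^esub>) \<sqsubseteq>\<^bsub>vorder Y\<^esub> w k"
      using dw by (auto simp: dominated_by_def)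
    obtain j where j: "j \<in> J" "fst p = y j" using fstI p by (metis imageE)
    obtain a where a: "a \<in> I" "\<forall>\<alpha>\<in>I. (a, \<alpha>) \<in> r \<longrightarrow> (y j, x \<alpha>) \<in> I'" using tail j by blast
    have "modulus Y (T (x \<alpha>) \<ominus>\<^bsub>Y\<^esub> \<zero>\<^bsub>Y\<^esub>) \<sqsubseteq>\<^bsub>vorder Y\<^esub> w k" if "\<alpha> \<in> I" "(a, \<alpha>) \<in> r" for \<alpha>
    proof -
      have "(y j, x \<alpha>) \<in> I'" using a that by blast
      moreover have "(p, (y j, x \<alpha>)) \<in> r'"
        using calculation p j refl fstI[of p] by (auto simp: r'_def)
      ultimately show ?thesis using p by fastforce
    qed
    then show "\<exists>\<alpha>\<^sub>0\<in>I. \<forall>\<alpha>\<in>I. (\<alpha>\<^sub>0, \<alpha>) \<in> r \<longrightarrow>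
        modulus Y (T (x \<alpha>) \<ominus>\<^bsub>Y\<^esub> \<zero>\<^bsub>Y\<^esub>) \<sqsubseteq>\<^bsub>vorder Y\<^esub> w k"
      using a by blast
  qed
  moreover have "(\<lambda>i. T (x i)) \<in> I \<rightarrow> carrier Y" using T(2) xI by auto
  ultimately show ?thesis using I zY w unfolding order_converges_def by blast
qed


section \<open>The two model vector lattices\<close>

lemma archimedean_c00: "archimedean_vector_lattice (c00 \<Lambda>)"
proof -
  let ?C = "carrier (c00 \<Lambda>)"
  have C: "f \<in> ?C \<longleftrightarrow> (\<forall>i. i \<notin> \<Lambda> \<longrightarrow> f i = 0) \<and> finite {i. f i \<noteq> 0}" for f
    by (simp add: c00_def)
  have comb: "(\<lambda>i. h (f i) (g i)) \<in> ?C" if "f \<in> ?C" "g \<in> ?C" "h 0 0 = 0" for f g and h :: "real \<Rightarrow> real \<Rightarrow> real"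
    using that finite_subset[of "{i. h (f i) (g i) \<noteq> 0}" "{i. f i \<noteq> 0} \<union> {i. g i \<noteq> 0}"]
    by (fastforce simp: C)
  have [simp]: "carrier (vorder (c00 \<Lambda>)) = ?C" "eq (vorder (c00 \<Lambda>)) = (=)"
    "le (vorder (c00 \<Lambda>)) f g \<longleftrightarrow> (\<forall>i\<in>\<Lambda>. f i \<le> g i)" for f g
    by (auto simp: vorder_def c00_def)
  have [simp]: "add (c00 \<Lambda>) f g = (\<lambda>i. f i + g i)" "zero (c00 \<Lambda>) = (\<lambda>i. 0)"
    "smult (c00 \<Lambda>) a f = (\<lambda>i. a * f i)" for f g a
    by (auto simp: c00_def)
  have ag: "abelian_group (c00 \<Lambda>)"
  proof (rule abelian_groupI)
    show "\<And>f g. f \<in> ?C \<Longrightarrow> g \<in> ?C \<Longrightarrow> f \<oplus>\<^bsub>c00 \<Lambda>\<^esub> g \<in> ?C" using comb[where h = "(+)"] by simp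
    show "\<And>f. f \<in> ?C \<Longrightarrow> \<exists>g\<in>?C. g \<oplus>\<^bsub>c00 \<Lambda>\<^esub> f = \<zero>\<^bsub>c00 \<Lambda>\<^esub>"
      using comb[where h = "\<lambda>a b. - a"] by (intro bexI[of _ "\<lambda>i. - _ i"]) auto
  qed (auto simp: algebra_simps C)
  have mod: "module real_ring (c00 \<Lambda>)"
  proof (rule moduleI[OF _ ag])
    show "cring real_ring" by (rule cring_real_ring)
    show "\<And>a f. f \<in> ?C \<Longrightarrow> a \<odot>\<^bsub>c00 \<Lambda>\<^esub> f \<in> ?C" for a
      using comb[where h = "\<lambda>x y. a * x" for a] by simp
  qed (auto simp: real_ring_def algebra_simps)
  have po: "partial_order (vorder (c00 \<Lambda>))"
  proof unfold_locales
    fix f g assume "f \<sqsubseteq>\<^bsub>vorder (c00 \<Lambda>)\<^esub> g" "g \<sqsubseteq>\<^bsub>vorder (c00 \<Lambda>)\<^esub> f"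
      "f \<in> carrier (vorder (c00 \<Lambda>))" "g \<in> carrier (vorder (c00 \<Lambda>))"
    then have "f i = g i" for i by (cases "i \<in> \<Lambda>") (auto simp: C intro: antisym)
    then show "f .=\<^bsub>vorder (c00 \<Lambda>)\<^esub> g" by auto
  qed (auto intro: order_trans)
  have lat: "Lattice.lattice (vorder (c00 \<Lambda>))"
  proof -
    interpret partial_order "vorder (c00 \<Lambda>)" by (rule po)
    show ?thesis
    proof unfold_locales
      fix f g assume fg: "f \<in> carrier (vorder (c00 \<Lambda>))" "g \<in> carrier (vorder (c00 \<Lambda>))"
      show "\<exists>s. least (vorder (c00 \<Lambda>)) s (Upper (vorder (c00 \<Lambda>)) {f, g})"
        using fg comb[of f g max] by (intro exI[of _ "\<lambda>i. max (f i) (g i)"]) (auto simp: least_def Upper_def)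
      show "\<exists>s. greatest (vorder (c00 \<Lambda>)) s (Lower (vorder (c00 \<Lambda>)) {f, g})"
        using fg comb[of f g min] by (intro exI[of _ "\<lambda>i. min (f i) (g i)"]) (auto simp: greatest_def Lower_def)
    qed
  qed
  have arch: "f = (\<lambda>i. 0)"
    if f: "f \<in> ?C" and nn: "\<forall>i\<in>\<Lambda>. 0 \<le> f i" and le: "\<And>n::nat. \<forall>i\<in>\<Lambda>. real n * f i \<le> g i" for f g
  proof -
    have "f i = 0" for i
    proof (rule ccontr)
      assume "f i \<noteq> 0"
      then have i: "i \<in> \<Lambda>" "0 < f i" using f nn by (force simp: C)+
      obtain n :: nat where "g i < real n * f i" using i reals_Archimedean3 by blast
      then show False using le[of n] i by force
    qed
    then show ?thesis by auto
  qed
  show ?thesis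
    by (intro archimedean_vector_lattice.intro vector_lattice.intro mod lat
        vector_lattice_axioms.intro archimedean_vector_lattice_axioms.intro)
      (auto intro: arch[simplified])
qed

lemma archimedean_real_vlat: "archimedean_vector_lattice real_vlat"
proof -
  have ag: "abelian_group real_vlat"
    by (rule abelian_groupI) (auto simp: real_vlat_def intro: exI[of _ "- _"])
  have mod: "module real_ring real_vlat"
    by (rule moduleI[OF cring_real_ring ag])
      (auto simp: real_vlat_def real_ring_def algebra_simps)
  have po: "partial_order (vorder real_vlat)"
    by unfold_locales (auto simp: vorder_def real_vlat_def)
  have lat: "Lattice.lattice (vorder real_vlat)"
  proof -
    interpret partial_order "vorder real_vlat" by (rule po)
    show ?thesis
    proof unfold_locales
      fix a b
      show "\<exists>s. least (vorder real_vlat) s (Upper (vorder real_vlat) {a, b})"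
        by (intro exI[of _ "max a b"]) (auto simp: least_def Upper_def vorder_def real_vlat_def)
      show "\<exists>s. greatest (vorder real_vlat) s (Lower (vorder real_vlat) {a, b})"
        by (intro exI[of _ "min a b"]) (auto simp: greatest_def Lower_def vorder_def real_vlat_def)
    qed
  qed
  have arch: "x = 0" if "0 \<le> x" "\<And>n::nat. real n * x \<le> y" for x y :: real
    using that reals_Archimedean3[of x] by (metis less_eq_real_def not_less)
  show ?thesis
    by (intro archimedean_vector_lattice.intro vector_lattice.intro mod lat
        vector_lattice_axioms.intro archimedean_vector_lattice_axioms.intro)
      (use arch in \<open>auto simp: vorder_def real_vlat_def\<close>)
qed

end

theory Submission
  imports Defs
begin

text \<open>
  Let every linear functional on \<open>X\<close> be order bounded. A sequence of pairwise orthogonal nonzero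
  elements \<open>e\<^sub>n\<close> of an interval \<open>[0, x]\<close> is linearly independent, so some linear functional
  maps \<open>e\<^sub>n\<close> to \<open>n\<close>; it is unbounded on the interval. Hence there is no such
  sequence. In an Archimedean lattice an element that is not an atom dominates two nonzero orthogonal
  elements, so every positive element dominates an atom, and only finitely many pairwise orthogonal
  atoms have a nonzero coordinate at a given \<open>x\<close>. The coordinates therefore give the isomorphism
  with \<open>c00\<close>.

  Conversely, on \<open>c00\<close> a net that converges to zero in order is eventually supported in one
  finite set and converges uniformly there, which any linear operator preserves. Order continuity
  yields order boundedness on \<open>[0, v]\<close> by the net \<open>(n, y) \<mapsto> y / n\<close>, and the functionals are
  recovered from operators into a copy of the reals inside the universe type.
\<close>

section \<open>Linear functionals\<close>

text \<open>No element is ever expanded as a sum of atoms. Coordinates only have to detect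
  positivity: an atom under the negative part of an element forces a strictly negative coordinate.
  Injectivity is then antisymmetry of the order, and surjectivity needs only finite sums; hence the
  insistence on atoms below every nonzero positive element. Two devices keep the algebra in explicit
  carriers manageable. Linear functionals separate points, so a vector identity becomes an identity
  of reals; and disjointness is expressed by common positive lower bounds, so that it is handled by
  inequalities. The extension of partial functionals by Zorn's lemma provides both this separation
  and the unbounded functional. In the converse direction an arbitrary \<open>Y\<close> offers no
  norm in which to express uniform convergence. Its place is taken by one positive element
  \<open>W\<close> built from the images of finitely many unit vectors, and the images are compared
  with small multiples of \<open>W\<close>.\<close>

lemma vorder_simps [simp]:
  "carrier (vorder X) = carrier X" "eq (vorder X) = (=)" "le (vorder X) = vle X"
  by (auto simp: vorder_def)

context vector_lattice
begin

lemma scale_closed [simp, intro]: "x \<in> carrier X \<Longrightarrow> a \<odot> x \<in> carrier X"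
  using smult_closed[of a x] by (simp add: real_ring_def)

lemma scale_left_distrib: "x \<in> carrier X \<Longrightarrow> (a + b) \<odot> x = a \<odot> x \<oplus> b \<odot> x"
  using smult_l_distr[of a b x] by (simp add: real_ring_def)

lemma scale_right_distrib:
  "\<lbrakk>x \<in> carrier X; y \<in> carrier X\<rbrakk> \<Longrightarrow> a \<odot> (x \<oplus> y) = a \<odot> x \<oplus> a \<odot> y"
  using smult_r_distr[of a x y] by (simp add: real_ring_def)

lemma scale_scale: "x \<in> carrier X \<Longrightarrow> a \<odot> (b \<odot> x) = (a * b) \<odot> x"
  using smult_assoc1[of a b x] by (simp add: real_ring_def)

lemma scale_one [simp]: "x \<in> carrier X \<Longrightarrow> 1 \<odot> x = x"
  using smult_one[of x] by (simp add: real_ring_def)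

lemma scale_zero_left [simp]: "x \<in> carrier X \<Longrightarrow> 0 \<odot> x = \<zero>"
  using smult_l_null[of x] by (simp add: real_ring_def)

lemma scale_zero_right [simp]: "a \<odot> \<zero> = \<zero>"
  using smult_r_null[of a] by (simp add: real_ring_def)

lemma minus_eq_scale: "x \<in> carrier X \<Longrightarrow> \<ominus> x = (-1) \<odot> x"
proof -
  assume x: "x \<in> carrier X"
  have "(-1) \<odot> x \<oplus> x = \<zero>"
    using scale_left_distrib[OF x, of "-1" 1] x by simp
  then show ?thesis using x by (simp add: M.minus_equality)
qed

lemma scale_eq_zero_imp:
  assumes "x \<in> carrier X" "a \<odot> x = \<zero>" "a \<noteq> 0" shows "x = \<zero>"
proof -
  have "x = inverse a \<odot> (a \<odot> x)" using assms(1,3) by (simp add: scale_scale)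
  also have "\<dots> = \<zero>" by (simp add: assms(2))
  finally show ?thesis .
qed

text \<open>A functional on a subspace is encoded by its graph, so that extension is inclusion and
  Zorn's lemma for sets applies. Single-valuedness is demanded at zero only: the difference of two
  values at one point is a value at zero.\<close>

definition linear_graph :: "('a \<times> real) set \<Rightarrow> bool" where
  "linear_graph M \<longleftrightarrow> M \<subseteq> carrier X \<times> UNIV \<and> (\<zero>, 0) \<in> M \<and>
     (\<forall>x s y t. (x, s) \<in> M \<longrightarrow> (y, t) \<in> M \<longrightarrow> (x \<oplus> y, s + t) \<in> M) \<and>
     (\<forall>a x s. (x, s) \<in> M \<longrightarrow> (a \<odot> x, a * s) \<in> M) \<and>
     (\<forall>t. (\<zero>, t) \<in> M \<longrightarrow> t = 0)"

text \<open>The sum of the graph and the line through \<open>(x, t)\<close>. It is again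
  single-valued when \<open>x\<close> lies outside the old domain.\<close>

definition adjoin :: "('a \<times> real) set \<Rightarrow> 'a \<Rightarrow> real \<Rightarrow> ('a \<times> real) set" where
  "adjoin M x t = {(y \<oplus> c \<odot> x, s + c * t) | y s c. (y, s) \<in> M}"

lemma linear_graph_zero: "linear_graph {(\<zero>, 0)}"
  by (auto simp: linear_graph_def)

lemma subset_adjoin:
  assumes "linear_graph M" "x \<in> carrier X" shows "M \<subseteq> adjoin M x t"
proof
  fix p assume "p \<in> M"
  moreover obtain y s where "p = (y, s)" by force
  ultimately have "(y, s) \<in> M" "p = (y \<oplus> 0 \<odot> x, s + 0 * t)"
    using assms by (auto simp: linear_graph_def)
  then show "p \<in> adjoin M x t" unfolding adjoin_def by blast
qed

lemma mem_adjoin: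
  assumes "linear_graph M" "x \<in> carrier X" shows "(x, t) \<in> adjoin M x t"
proof -
  have "(\<zero>, 0) \<in> M" using assms(1) by (simp add: linear_graph_def)
  moreover have "(x, t) = (\<zero> \<oplus> 1 \<odot> x, 0 + 1 * t)" using assms(2) by simp
  ultimately show ?thesis unfolding adjoin_def by blast
qed

text \<open>Single-valuedness is the crux. A relation \<open>y + c x = 0\<close> with
  \<open>c\<close> nonzero would exhibit \<open>x\<close> as a multiple of a point of the domain of
  \<open>M\<close>; hence \<open>c = 0\<close>, and the value at zero is already one of
  \<open>M\<close>.\<close>

lemma linear_graph_adjoin:
  assumes M: "linear_graph M" and x: "x \<in> carrier X" and new: "x \<notin> Domain M"
  shows "linear_graph (adjoin M x t)"
  unfolding linear_graph_def
proof (intro conjI allI impI)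
  have C: "y \<in> carrier X" if "(y, s) \<in> M" for y s
    using M that by (auto simp: linear_graph_def)
  show "adjoin M x t \<subseteq> carrier X \<times> UNIV" using C x by (auto simp: adjoin_def)
  show "(\<zero>, 0) \<in> adjoin M x t"
    using M subset_adjoin[OF M x] by (auto simp: linear_graph_def)
  show "(y \<oplus> z, s + r) \<in> adjoin M x t" if yz: "(y, s) \<in> adjoin M x t" "(z, r) \<in> adjoin M x t" for y z s r
  proof -
    obtain y' s' c where y: "y = y' \<oplus> c \<odot> x" "s = s' + c * t" "(y', s') \<in> M"
      using yz by (auto simp: adjoin_def)
    obtain z' r' d where z: "z = z' \<oplus> d \<odot> x" "r = r' + d * t" "(z', r') \<in> M"
      using yz by (auto simp: adjoin_def)
    have "y \<oplus> z = (y' \<oplus> z') \<oplus> (c + d) \<odot> x"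
      using C[OF y(3)] C[OF z(3)] x y z by (simp add: scale_left_distrib M.a_ac)
    moreover have "s + r = (s' + r') + (c + d) * t" using y z by (simp add: algebra_simps)
    moreover have "(y' \<oplus> z', s' + r') \<in> M" using M y z by (auto simp: linear_graph_def)
    ultimately show ?thesis unfolding adjoin_def by blast
  qed
  show "(a \<odot> y, a * s) \<in> adjoin M x t" if yz: "(y, s) \<in> adjoin M x t" for y s a
  proof -
    obtain y' s' c where y: "y = y' \<oplus> c \<odot> x" "s = s' + c * t" "(y', s') \<in> M"
      using yz by (auto simp: adjoin_def)
    have "a \<odot> y = a \<odot> y' \<oplus> (a * c) \<odot> x"
      using C[OF y(3)] x y by (simp add: scale_right_distrib scale_scale)
    moreover have "a * s = a * s' + (a * c) * t" using y by (simp add: algebra_simps)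
    moreover have "(a \<odot> y', a * s') \<in> M" using M y by (auto simp: linear_graph_def)
    ultimately show ?thesis unfolding adjoin_def by blast
  qed
  show "r = 0" if "(\<zero>, r) \<in> adjoin M x t" for r
  proof -
    obtain y s c where y: "\<zero> = y \<oplus> c \<odot> x" "r = s + c * t" "(y, s) \<in> M"
      using \<open>(\<zero>, r) \<in> adjoin M x t\<close> by (auto simp: adjoin_def)
    have "c = 0"
    proof (rule ccontr)
      assume c: "c \<noteq> 0"
      have "y \<oplus> c \<odot> x = \<zero>" using y by simp
      then have "y = \<ominus> (c \<odot> x)" using C[OF y(3)] x by (metis M.minus_equality scale_closed)
      then have "y = (- c) \<odot> x" using x by (simp add: minus_eq_scale scale_scale)
      then have "(- inverse c) \<odot> y = x" using x c by (simp add: scale_scale)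
      moreover have "((- inverse c) \<odot> y, (- inverse c) * s) \<in> M"
        using M y(3) unfolding linear_graph_def by blast
      ultimately show False using new by auto
    qed
    then show ?thesis using y x C[OF y(3)] M by (auto simp: linear_graph_def)
  qed
qed

lemma linear_graph_extends:
  assumes M0: "linear_graph M0"
  obtains f where "f \<in> algebraic_dual X" "\<And>x t. (x, t) \<in> M0 \<Longrightarrow> f x = t"
proof -
  let ?S = "{M. linear_graph M \<and> M0 \<subseteq> M}"
  have "\<exists>M\<in>?S. \<forall>N\<in>?S. M \<subseteq> N \<longrightarrow> N = M"
  proof (rule subset_Zorn_nonempty)
    show "?S \<noteq> {}" using M0 by auto
    fix \<C> assume ne: "\<C> \<noteq> {}" and ch: "subset.chain ?S \<C>"
    have in_S: "linear_graph M" "M0 \<subseteq> M" if "M \<in> \<C>" for M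
      using ch that by (auto simp: subset_chain_def)
    have "linear_graph (\<Union>\<C>)"
      unfolding linear_graph_def
    proof (intro conjI allI impI)
      show "\<Union>\<C> \<subseteq> carrier X \<times> UNIV" using in_S unfolding linear_graph_def by blast
      show "(\<zero>, 0) \<in> \<Union>\<C>" using in_S ne unfolding linear_graph_def by blast
      show "(a \<odot> y, a * s) \<in> \<Union>\<C>" if "(y, s) \<in> \<Union>\<C>" for y s a
        using in_S that unfolding linear_graph_def by blast
      show "t = 0" if "(\<zero>, t) \<in> \<Union>\<C>" for t
        using in_S that unfolding linear_graph_def by blast
      fix x s y t assume "(x, s) \<in> \<Union>\<C>" "(y, t) \<in> \<Union>\<C>"
      then obtain M N where MN: "(x, s) \<in> M" "M \<in> \<C>" "(y, t) \<in> N" "N \<in> \<C>" by blast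
      then have "M \<subseteq> N \<or> N \<subseteq> M" using ch by (auto simp: subset_chain_def)
      then show "(x \<oplus> y, s + t) \<in> \<Union>\<C>"
        using MN in_S unfolding linear_graph_def by (metis UnionI subsetD)
    qed
    then show "\<Union>\<C> \<in> ?S" using ne in_S by blast
  qed
  then obtain M where M: "linear_graph M" "M0 \<subseteq> M"
    and max: "\<And>N. linear_graph N \<Longrightarrow> M \<subseteq> N \<Longrightarrow> N = M" by (auto intro: subset_trans)
  have tot: "\<exists>t. (x, t) \<in> M" if x: "x \<in> carrier X" for x
  proof (rule ccontr)
    assume n: "\<nexists>t. (x, t) \<in> M"
    \<comment> \<open>A point missing from the domain could be adjoined with an arbitrary value,
      here 0, against maximality.\<close>
    then have "adjoin M x 0 = M"
      using max linear_graph_adjoin[OF M(1) x, of 0] subset_adjoin[OF M(1) x] by auto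
    then show False using mem_adjoin[OF M(1) x, of 0] n by simp
  qed
  have uniq: "s = t" if st: "(x, s) \<in> M" "(x, t) \<in> M" for x s t
  proof -
    have x: "x \<in> carrier X" using st M by (auto simp: linear_graph_def)
    have "((-1) \<odot> x, (-1) * t) \<in> M" using M(1) st unfolding linear_graph_def by blast
    then have "(x \<oplus> (-1) \<odot> x, s + (-1) * t) \<in> M" using M(1) st unfolding linear_graph_def by blast
    moreover have "x \<oplus> (-1) \<odot> x = \<zero>" using x by (simp add: minus_eq_scale[symmetric] M.r_neg)
    ultimately have "s - t = 0" using M(1) by (auto simp: linear_graph_def)
    then show ?thesis by simp
  qed
  define f where "f = restrict (\<lambda>x. THE t. (x, t) \<in> M) (carrier X)"
  have f: "f x = t" if "(x, t) \<in> M" for x t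
  proof -
    have "x \<in> carrier X" using that M(1) by (auto simp: linear_graph_def)
    moreover have "(THE t. (x, t) \<in> M) = t" by (rule the_equality, rule that, erule uniq[OF _ that])
    ultimately show ?thesis by (simp add: f_def)
  qed
  have fM: "(x, f x) \<in> M" if "x \<in> carrier X" for x using tot[OF that] f by auto
  have "f \<in> algebraic_dual X"
    unfolding linear_ops_def
  proof (intro CollectI conjI ballI allI)
    show "f \<in> carrier X \<rightarrow>\<^sub>E carrier real_vlat" by (auto simp: f_def real_vlat_def)
    fix x assume x: "x \<in> carrier X"
    show "f (x \<oplus> y) = f x \<oplus>\<^bsub>real_vlat\<^esub> f y" if "y \<in> carrier X" for y
    proof -
      have "(x \<oplus> y, f x + f y) \<in> M"
        using fM[OF x] fM[OF that] M(1) by (simp add: linear_graph_def)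
      from f[OF this] show ?thesis by (simp add: real_vlat_def)
    qed
    show "f (a \<odot> x) = a \<odot>\<^bsub>real_vlat\<^esub> f x" for a
    proof -
      have "(a \<odot> x, a * f x) \<in> M" using fM[OF x] M(1) by (simp add: linear_graph_def)
      from f[OF this] show ?thesis by (simp add: real_vlat_def)
    qed
  qed
  moreover have "f x = t" if "(x, t) \<in> M0" for x t using f that M(2) by blast
  ultimately show thesis by (rule that)
qed

lemma functional_add [simp]:
  "\<lbrakk>f \<in> algebraic_dual X; x \<in> carrier X; y \<in> carrier X\<rbrakk> \<Longrightarrow> f (x \<oplus> y) = f x + f y"
  by (simp add: linear_ops_def real_vlat_def)

lemma functional_scale [simp]:
  "\<lbrakk>f \<in> algebraic_dual X; x \<in> carrier X\<rbrakk> \<Longrightarrow> f (a \<odot> x) = a * f x"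
  by (simp add: linear_ops_def real_vlat_def)

lemma functional_zero [simp]: "f \<in> algebraic_dual X \<Longrightarrow> f \<zero> = 0"
  using functional_scale[of f "\<zero>" 0] by simp

lemma functional_minus [simp]:
  "\<lbrakk>f \<in> algebraic_dual X; x \<in> carrier X\<rbrakk> \<Longrightarrow> f (\<ominus> x) = - f x"
  by (simp add: minus_eq_scale)

lemma functional_diff [simp]:
  "\<lbrakk>f \<in> algebraic_dual X; x \<in> carrier X; y \<in> carrier X\<rbrakk> \<Longrightarrow> f (x \<ominus> y) = f x - f y"
  by (simp add: M.minus_eq)

text \<open>Linear functionals separate points, so identities in \<open>X\<close> reduce to real arithmetic.\<close>

lemma vector_eqI:
  assumes x: "x \<in> carrier X" and y: "y \<in> carrier X"
    and eq: "\<And>f. f \<in> algebraic_dual X \<Longrightarrow> f x = f y"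
  shows "x = y"
proof (rule ccontr)
  assume "x \<noteq> y"
  moreover have "x = y" if "x \<ominus> y = \<zero>"
    using M.minus_equality[of x "\<ominus> y"] that x y by (simp add: M.minus_eq)
  ultimately have z: "x \<ominus> y \<in> carrier X" "x \<ominus> y \<noteq> \<zero>" using x y by auto
  \<comment> \<open>Since the difference is nonzero, the value 1 may be prescribed on it; the
    extension then separates \<open>x\<close> from \<open>y\<close>.\<close>
  then have "linear_graph (adjoin {(\<zero>, 0)} (x \<ominus> y) 1)"
    by (intro linear_graph_adjoin linear_graph_zero) auto
  then obtain f where f: "f \<in> algebraic_dual X" "f (x \<ominus> y) = 1"
    using linear_graph_extends mem_adjoin[OF linear_graph_zero z(1)] by metis
  then show False using eq[OF f(1)] x y by simp
qed

section \<open>Inequalities as nonnegative combinations\<close>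

lemma le_iff_diff_nonneg:
  assumes x: "x \<in> carrier X" and y: "y \<in> carrier X"
  shows "vle X x y \<longleftrightarrow> vle X \<zero> (y \<ominus> x)"
proof
  assume "vle X x y"
  then have "vle X (x \<oplus> \<ominus> x) (y \<oplus> \<ominus> x)" using add_mono[of x y "\<ominus> x"] x y by simp
  then show "vle X \<zero> (y \<ominus> x)" using x y by (simp add: M.r_neg M.minus_eq)
next
  assume "vle X \<zero> (y \<ominus> x)"
  then have "vle X (\<zero> \<oplus> x) ((y \<ominus> x) \<oplus> x)" using add_mono[of "\<zero>" "y \<ominus> x" x] x y by simp
  moreover have "(y \<ominus> x) \<oplus> x = y" using x y by (intro vector_eqI) auto
  ultimately show "vle X x y" using x by simp
qed

lemma le_refl [simp]: "x \<in> carrier X \<Longrightarrow> vle X x x"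
  using order.le_refl[of x] by simp

lemma le_trans:
  "\<lbrakk>vle X x y; vle X y z; x \<in> carrier X; y \<in> carrier X; z \<in> carrier X\<rbrakk> \<Longrightarrow> vle X x z"
  using order.le_trans[of x y z] by simp

lemma le_antisym:
  "\<lbrakk>vle X x y; vle X y x; x \<in> carrier X; y \<in> carrier X\<rbrakk> \<Longrightarrow> x = y"
  using order.le_antisym[of x y] by simp

text \<open>The certificate form of order reasoning: \<open>y - x\<close> is a nonnegative
  combination of two known nonnegative differences, and that identity is checked on functionals as
  real arithmetic. The explicit coefficients in later applications are such certificates.\<close>

lemma le_combination:
  assumes C: "x \<in> carrier X" "y \<in> carrier X" "x1 \<in> carrier X" "y1 \<in> carrier X"
      "x2 \<in> carrier X" "y2 \<in> carrier X"
    and le: "vle X x1 y1" "vle X x2 y2" and "0 \<le> a" "0 \<le> b"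
    and eq: "\<And>f. f \<in> algebraic_dual X \<Longrightarrow>
      f y - f x = a * (f y1 - f x1) + b * (f y2 - f x2)"
  shows "vle X x y"
proof -
  let ?u = "a \<odot> (y1 \<ominus> x1)" and ?v = "b \<odot> (y2 \<ominus> x2)"
  have "vle X \<zero> ?u" "vle X \<zero> ?v"
    using smult_nonneg assms by (auto simp: le_iff_diff_nonneg[of x1] le_iff_diff_nonneg[of x2])
  moreover have "vle X (\<zero> \<oplus> ?v) (?u \<oplus> ?v)"
    using add_mono[of "\<zero>" ?u ?v] calculation C by simp
  ultimately have "vle X \<zero> (?u \<oplus> ?v)" using C le_trans[of "\<zero>" ?v "?u \<oplus> ?v"] by simp
  moreover have "?u \<oplus> ?v = y \<ominus> x" using C eq by (intro vector_eqI) auto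
  ultimately show ?thesis using le_iff_diff_nonneg C by simp
qed

lemma le_scaled:
  assumes "x \<in> carrier X" "y \<in> carrier X" "x1 \<in> carrier X" "y1 \<in> carrier X"
    and "vle X x1 y1" "0 \<le> a"
    and eq: "\<And>f. f \<in> algebraic_dual X \<Longrightarrow> f y - f x = a * (f y1 - f x1)"
  shows "vle X x y"
  by (rule le_combination[of x y x1 y1 "\<zero>" "\<zero>" a 0]) (use assms(1-6) in \<open>auto simp: eq\<close>)

end

section \<open>Orthogonal complements and atoms\<close>

context vector_lattice
begin

text \<open>Disjointness of positive elements, that is, meet equal to zero, phrased by common
  positive lower bounds. Positivity of both elements is built in and is often extracted from
  it.\<close>

definition orthogonal :: "'a \<Rightarrow> 'a \<Rightarrow> bool" where
  "orthogonal u a \<longleftrightarrow> u \<in> carrier X \<and> a \<in> carrier X \<and> vle X \<zero> u \<and> vle X \<zero> a \<and>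
     (\<forall>w\<in>carrier X. vle X \<zero> w \<longrightarrow> vle X w u \<longrightarrow> vle X w a \<longrightarrow> w = \<zero>)"

lemma orthogonal_sym: "orthogonal u a \<Longrightarrow> orthogonal a u"
  by (auto simp: orthogonal_def)

lemma orthogonal_carrier: "orthogonal u a \<Longrightarrow> u \<in> carrier X \<and> a \<in> carrier X"
  by (simp add: orthogonal_def)

lemma orthogonal_self: "orthogonal a a \<Longrightarrow> a = \<zero>"
  by (auto simp: orthogonal_def)

lemma orthogonal_zero: "\<lbrakk>a \<in> carrier X; vle X \<zero> a\<rbrakk> \<Longrightarrow> orthogonal \<zero> a"
  by (auto simp: orthogonal_def intro: le_antisym)

lemma orthogonal_mono:
  "\<lbrakk>orthogonal u a; v \<in> carrier X; vle X \<zero> v; vle X v u\<rbrakk> \<Longrightarrow> orthogonal v a"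
  unfolding orthogonal_def by (meson le_trans)

text \<open>Here \<open>p\<close> is the join of \<open>z\<close> with zero and
  \<open>n = p - z\<close>. If \<open>w\<close> is a positive lower bound of both,
  \<open>p - w\<close> is still an upper bound of \<open>z\<close> and zero, so
  \<open>p \<le> p - w\<close> and \<open>w = 0\<close>. The last clause records that
  \<open>p\<close> is least; this is how \<open>p\<close> is bounded from above later.\<close>

lemma positive_parts:
  assumes z: "z \<in> carrier X"
  obtains p n where "orthogonal p n" "z = p \<ominus> n" "vle X z p"
    "\<forall>u\<in>carrier X. vle X z u \<longrightarrow> vle X \<zero> u \<longrightarrow> vle X p u"
proof -
  define p where "p = z \<squnion>\<^bsub>vorder X\<^esub> \<zero>"
  have p: "p \<in> carrier X" "vle X z p" "vle X \<zero> p"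
    using order.join_closed[of z "\<zero>"] order.join_left[of z "\<zero>"] order.join_right[of z "\<zero>"] z
    by (auto simp: p_def)
  have least: "\<forall>u\<in>carrier X. vle X z u \<longrightarrow> vle X \<zero> u \<longrightarrow> vle X p u"
    using order.join_le[of z _ "\<zero>"] z by (simp add: p_def)
  have n: "p \<ominus> z \<in> carrier X" "vle X \<zero> (p \<ominus> z)"
    using p z le_iff_diff_nonneg by auto
  have "orthogonal p (p \<ominus> z)"
    unfolding orthogonal_def
  proof (intro conjI ballI impI)
    fix w assume w: "w \<in> carrier X" "vle X \<zero> w" "vle X w p" "vle X w (p \<ominus> z)"
    have "vle X p (p \<ominus> w)"
    proof (rule least[rule_format])
      show "vle X z (p \<ominus> w)"
        by (rule le_scaled[of _ _ w "p \<ominus> z" 1]) (use w p z in auto)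
      show "vle X \<zero> (p \<ominus> w)"
        by (rule le_scaled[of _ _ w p 1]) (use w p z in auto)
    qed (use w p in simp)
    then have "vle X w \<zero>"
      by (intro le_scaled[of w "\<zero>" p "p \<ominus> w" 1]) (use w p in auto)
    then show "w = \<zero>" using w by (simp add: le_antisym)
  qed (use p n in auto)
  moreover have "z = p \<ominus> (p \<ominus> z)" using p z by (intro vector_eqI) auto
  ultimately show thesis using that p least by blast
qed

text \<open>If \<open>w\<close> lies below \<open>u + v\<close> and below \<open>a\<close>, the
  positive part of \<open>w - v\<close> lies below \<open>u\<close> and below \<open>a\<close>,
  hence vanishes. So \<open>w \<le> v\<close>, and orthogonality of \<open>v\<close> and
  \<open>a\<close> finishes.\<close>

lemma orthogonal_add:
  assumes u: "orthogonal u a" and v: "orthogonal v a" shows "orthogonal (u \<oplus> v) a"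
proof -
  have C: "u \<in> carrier X" "v \<in> carrier X" "a \<in> carrier X" "vle X \<zero> u" "vle X \<zero> v" "vle X \<zero> a"
    using u v by (auto simp: orthogonal_def)
  have "w = \<zero>" if w: "w \<in> carrier X" "vle X \<zero> w" "vle X w (u \<oplus> v)" "vle X w a" for w
  proof -
    have "w \<ominus> v \<in> carrier X" using w C by simp
    then obtain p n where p: "orthogonal p n" "vle X (w \<ominus> v) p"
      and least: "\<forall>u\<in>carrier X. vle X (w \<ominus> v) u \<longrightarrow> vle X \<zero> u \<longrightarrow> vle X p u"
      by (rule positive_parts)
    have "vle X (w \<ominus> v) u"
      by (rule le_scaled[of _ _ w "u \<oplus> v" 1]) (use w C in auto)
    moreover have "vle X (w \<ominus> v) a"
      by (rule le_combination[of _ _ w a "\<zero>" v 1 1]) (use w C in auto)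
    ultimately have "vle X p u" "vle X p a" using least C by auto
    then have "p = \<zero>" using u p by (auto simp: orthogonal_def)
    then have "vle X w v"
      by (intro le_scaled[of w v "w \<ominus> v" "\<zero>" 1]) (use w C p in auto)
    then show ?thesis using v w by (auto simp: orthogonal_def)
  qed
  moreover have "vle X \<zero> (u \<oplus> v)"
    by (rule le_combination[of _ _ "\<zero>" u "\<zero>" v 1 1]) (use C in auto)
  ultimately show ?thesis using C by (auto simp: orthogonal_def)
qed

lemma orthogonal_scale:
  assumes u: "orthogonal u a" and t: "0 \<le> t" shows "orthogonal (t \<odot> u) a"
proof -
  have C: "u \<in> carrier X" "a \<in> carrier X" "vle X \<zero> u" "vle X \<zero> a"
    using u by (auto simp: orthogonal_def)
  \<comment> \<open>Makes both \<open>c \<le> 1\<close> and \<open>c * t \<le> 1\<close>, so that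
    \<open>c w\<close> lies below \<open>a\<close> and below \<open>u\<close>.\<close>
  define c where "c = 1 / (t + 1)"
  have c: "0 < c" "c \<le> 1" "c * t \<le> 1" using t by (auto simp: c_def)
  have "w = \<zero>" if w: "w \<in> carrier X" "vle X \<zero> w" "vle X w (t \<odot> u)" "vle X w a" for w
  proof -
    have "vle X (c \<odot> w) u"
      by (rule le_combination[of _ _ w "t \<odot> u" "\<zero>" u c "1 - c * t"])
        (use w C c in \<open>auto simp: algebra_simps\<close>)
    moreover have "vle X (c \<odot> w) a"
      by (rule le_combination[of _ _ w a "\<zero>" a c "1 - c"])
        (use w C c in \<open>auto simp: algebra_simps\<close>)
    moreover have "vle X \<zero> (c \<odot> w)" using w c smult_nonneg by simp
    ultimately have "c \<odot> w = \<zero>" using u w by (auto simp: orthogonal_def)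
    then show ?thesis using c w scale_eq_zero_imp[of w c] by simp
  qed
  moreover have "vle X \<zero> (t \<odot> u)" using smult_nonneg C t by simp
  ultimately show ?thesis using C by (auto simp: orthogonal_def)
qed

text \<open>The disjoint complement of a positive \<open>a\<close>. Writing it as differences of
  positive elements reduces the subspace properties to \<open>orthogonal_add\<close> and
  \<open>orthogonal_scale\<close>.\<close>

definition complement :: "'a \<Rightarrow> 'a set" where
  "complement a = {u \<ominus> v | u v. orthogonal u a \<and> orthogonal v a}"

lemma complement_carrier: "x \<in> complement a \<Longrightarrow> x \<in> carrier X"
  by (auto simp: complement_def orthogonal_def)

lemma orthogonal_imp_complement: "orthogonal u a \<Longrightarrow> u \<in> complement a"
proof -
  assume u: "orthogonal u a"
  then have "orthogonal \<zero> a" by (intro orthogonal_zero) (auto simp: orthogonal_def)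
  moreover have "u = u \<ominus> \<zero>" using orthogonal_carrier[OF u] by (intro vector_eqI) auto
  ultimately show ?thesis using u unfolding complement_def by blast
qed

lemma complement_imp_orthogonal:
  assumes "x \<in> complement a" "vle X \<zero> x" shows "orthogonal x a"
proof -
  obtain u v where uv: "x = u \<ominus> v" "orthogonal u a" "orthogonal v a"
    using assms by (auto simp: complement_def)
  have "vle X x u"
    by (rule le_scaled[of x u "\<zero>" v 1]) (use uv in \<open>auto simp: orthogonal_def\<close>)
  then show ?thesis using uv assms complement_carrier orthogonal_mono by blast
qed

lemma complement_add:
  assumes "x \<in> complement a" "y \<in> complement a" shows "x \<oplus> y \<in> complement a"
proof -
  obtain u v where x: "x = u \<ominus> v" "orthogonal u a" "orthogonal v a"
    using assms by (auto simp: complement_def)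
  obtain u' v' where y: "y = u' \<ominus> v'" "orthogonal u' a" "orthogonal v' a"
    using assms by (auto simp: complement_def)
  have "x \<oplus> y = (u \<oplus> u') \<ominus> (v \<oplus> v')"
    using x y orthogonal_carrier by (intro vector_eqI) auto
  then show ?thesis using x y orthogonal_add unfolding complement_def by blast
qed

lemma complement_scale:
  assumes "x \<in> complement a" shows "t \<odot> x \<in> complement a"
proof -
  obtain u v where x: "x = u \<ominus> v" "orthogonal u a" "orthogonal v a"
    using assms by (auto simp: complement_def)
  show ?thesis
  proof (cases "0 \<le> t")
    case True
    have "t \<odot> x = t \<odot> u \<ominus> t \<odot> v"
      using x orthogonal_carrier by (intro vector_eqI) (auto simp: algebra_simps)
    then show ?thesis using x orthogonal_scale True unfolding complement_def by blast
  next
    case False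
    have "t \<odot> x = (- t) \<odot> v \<ominus> (- t) \<odot> u"
      using x orthogonal_carrier by (intro vector_eqI) (auto simp: algebra_simps)
    moreover have "orthogonal ((- t) \<odot> v) a" "orthogonal ((- t) \<odot> u) a" using x False by (auto intro: orthogonal_scale)
    ultimately show ?thesis unfolding complement_def by blast
  qed
qed

text \<open>Behind the uniqueness of coordinates: for nonzero \<open>t\<close>, rescaling would put
  \<open>a\<close> itself into its complement, making it orthogonal to itself.\<close>

lemma scale_mem_complement:
  assumes a: "a \<in> carrier X" "vle X \<zero> a" "a \<noteq> \<zero>" and t: "t \<odot> a \<in> complement a"
  shows "t = 0"
proof (rule ccontr)
  assume "t \<noteq> 0"
  then have "a = inverse t \<odot> (t \<odot> a)" using a by (simp add: scale_scale)
  then have "a \<in> complement a" using complement_scale t by metis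
  then show False using complement_imp_orthogonal orthogonal_self a by blast
qed

definition atom :: "'a \<Rightarrow> bool" where
  "atom a \<longleftrightarrow> a \<in> carrier X \<and> a \<noteq> \<zero> \<and> vle X \<zero> a \<and>
     (\<forall>y\<in>carrier X. vle X \<zero> y \<longrightarrow> vle X y a \<longrightarrow> (\<exists>t. y = t \<odot> a))"

lemma atomD:
  "atom a \<Longrightarrow> a \<in> carrier X" "atom a \<Longrightarrow> a \<noteq> \<zero>" "atom a \<Longrightarrow> vle X \<zero> a"
  by (auto simp: atom_def)

lemma scale_nonneg_iff:
  assumes "a \<in> carrier X" "vle X \<zero> a" "a \<noteq> \<zero>"
  shows "vle X \<zero> (t \<odot> a) \<longleftrightarrow> 0 \<le> t"
proof
  assume t: "vle X \<zero> (t \<odot> a)"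
  show "0 \<le> t"
  proof (rule ccontr)
    assume "\<not> 0 \<le> t"
    then have "vle X a \<zero>"
      by (intro le_scaled[of a "\<zero>" "\<zero>" "t \<odot> a" "- inverse t"]) (use t assms in auto)
    then show False using assms le_antisym by auto
  qed
qed (use assms smult_nonneg in auto)

lemma scale_le_iff:
  assumes "a \<in> carrier X" "vle X \<zero> a" "a \<noteq> \<zero>"
  shows "vle X (s \<odot> a) (t \<odot> a) \<longleftrightarrow> s \<le> t"
proof -
  have "t \<odot> a \<ominus> s \<odot> a = (t - s) \<odot> a" using assms by (intro vector_eqI) (auto simp: algebra_simps)
  then show ?thesis
    using le_iff_diff_nonneg[of "s \<odot> a" "t \<odot> a"] scale_nonneg_iff[OF assms, of "t - s"] assms by simp
qed

end

section \<open>Archimedean suprema of multiples, and coordinates along an atom\<close>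

context archimedean_vector_lattice
begin

text \<open>The axiom concerns positive elements, so it is applied to the positive part
  \<open>p\<close> of \<open>z\<close>: leastness gives \<open>p \<le> u / n\<close>, hence
  \<open>n p \<le> u\<close> for all \<open>n\<close>.\<close>

lemma le_zero_if_infinitesimal:
  assumes C: "z \<in> carrier X" "u \<in> carrier X" "vle X \<zero> u"
    and le: "\<And>e. 0 < e \<Longrightarrow> vle X z (e \<odot> u)"
  shows "vle X z \<zero>"
proof -
  obtain p n where p: "orthogonal p n" "vle X z p"
    and least: "\<forall>u\<in>carrier X. vle X z u \<longrightarrow> vle X \<zero> u \<longrightarrow> vle X p u"
    by (rule positive_parts[OF C(1)])
  have pC: "p \<in> carrier X" "vle X \<zero> p" using p by (auto simp: orthogonal_def)
  have "vle X (real n \<odot> p) u" for n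
  proof (cases "n = 0")
    case False
    have "vle X p ((1 / real n) \<odot> u)" using least le C smult_nonneg False by simp
    then show ?thesis
      by (intro le_scaled[of _ u p "(1 / real n) \<odot> u" "real n"])
        (use C pC False in \<open>auto simp: algebra_simps\<close>)
  qed (use C pC in simp)
  then have "p = \<zero>" using archimedean[of p u] C pC by simp
  then show ?thesis using p by simp
qed

lemma scale_bounded_above:
  assumes a: "a \<in> carrier X" "vle X \<zero> a" "a \<noteq> \<zero>" and x: "x \<in> carrier X"
  obtains b where "\<And>s. vle X (s \<odot> a) x \<Longrightarrow> s \<le> b"
proof -
  obtain n :: nat where n: "\<not> vle X (real n \<odot> a) x" using archimedean[of a x] a x by auto
  have "s \<le> real n" if "vle X (s \<odot> a) x" for s
  proof (rule ccontr)
    assume "\<not> s \<le> real n"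
    then have "vle X (real n \<odot> a) (s \<odot> a)" using scale_le_iff a by simp
    then show False using n that le_trans a x by blast
  qed
  then show thesis using that by blast
qed

text \<open>Some \<open>s\<close> in \<open>S\<close> exceeds \<open>Sup S - e\<close>, so
  \<open>Sup S\<close> times \<open>a\<close> exceeds \<open>x\<close> by at most \<open>e\<close>
  times \<open>a\<close>, for every \<open>e > 0\<close>. Thus the set of admissible multiples is
  closed under suprema.\<close>

lemma scale_sup_le:
  assumes a: "a \<in> carrier X" "vle X \<zero> a" and x: "x \<in> carrier X"
    and S: "S \<noteq> {}" "bdd_above S" "\<And>s. s \<in> S \<Longrightarrow> vle X (s \<odot> a) x"
  shows "vle X (Sup S \<odot> a) x"
proof -
  have "vle X (Sup S \<odot> a \<ominus> x) \<zero>"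
  proof (rule le_zero_if_infinitesimal[of _ a])
    fix e :: real assume "0 < e"
    then obtain s where s: "s \<in> S" "Sup S - e < s" using less_cSup_iff[OF S(1,2), of "Sup S - e"] by auto
    show "vle X (Sup S \<odot> a \<ominus> x) (e \<odot> a)"
      by (rule le_combination[of _ _ "s \<odot> a" x "\<zero>" a 1 "e - Sup S + s"])
        (use S(3)[OF s(1)] s(2) a x in \<open>auto simp: algebra_simps\<close>)
  qed (use a x in auto)
  then show ?thesis
    by (intro le_scaled[of "Sup S \<odot> a" x "Sup S \<odot> a \<ominus> x" "\<zero>" 1]) (use a x in auto)
qed

text \<open>The number \<open>s\<close> is the largest one whose multiple of \<open>a\<close> lies
  below \<open>x\<close>. Anything the remainder still shares with \<open>a\<close> is a multiple
  \<open>t a\<close>, because \<open>a\<close> is an atom; then \<open>s + t\<close> is admissible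
  as well, which forces \<open>t = 0\<close>.\<close>

lemma atom_split_nonneg:
  assumes a: "atom a" and x: "x \<in> carrier X" "vle X \<zero> x"
  obtains s where "0 \<le> s" "orthogonal (x \<ominus> s \<odot> a) a"
proof -
  note a' = atomD[OF a]
  let ?S = "{s. vle X (s \<odot> a) x}"
  obtain b where b: "\<And>s. vle X (s \<odot> a) x \<Longrightarrow> s \<le> b"
    using scale_bounded_above a' x by blast
  then have bdd: "bdd_above ?S" by (auto simp: bdd_above_def)
  have z: "0 \<in> ?S" using a' x by simp
  define s where "s = Sup ?S"
  have s: "vle X (s \<odot> a) x" unfolding s_def
    by (rule scale_sup_le[OF a'(1,3) x(1) _ bdd]) (use z in blast, simp)
  have d: "x \<ominus> s \<odot> a \<in> carrier X" "vle X \<zero> (x \<ominus> s \<odot> a)"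
    using s a' x le_iff_diff_nonneg by auto
  have "orthogonal (x \<ominus> s \<odot> a) a"
    unfolding orthogonal_def
  proof (intro conjI ballI impI)
    fix w assume w: "w \<in> carrier X" "vle X \<zero> w" "vle X w (x \<ominus> s \<odot> a)" "vle X w a"
    then obtain t where t: "w = t \<odot> a" using a by (auto simp: atom_def)
    then have "0 \<le> t" using w scale_nonneg_iff a' by simp
    have "vle X ((s + t) \<odot> a) x"
      by (rule le_scaled[of _ _ w "x \<ominus> s \<odot> a" 1]) (use w t a' x in \<open>auto simp: algebra_simps\<close>)
    then have "s + t \<le> s" unfolding s_def using bdd by (intro cSup_upper) auto
    then show "w = \<zero>" using \<open>0 \<le> t\<close> t a' by simp
  qed (use a' d in auto)
  moreover have "0 \<le> s" unfolding s_def using z bdd by (intro cSup_upper) auto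
  ultimately show thesis using that by blast
qed

text \<open>For an atom \<open>a\<close>, the coefficient of \<open>x\<close> in the splitting of
  the space into the line through \<open>a\<close> and its complement. \<open>coord_eqI\<close>
  gives uniqueness and \<open>coord_complement\<close> existence.\<close>

definition coord :: "'a \<Rightarrow> 'a \<Rightarrow> real" where
  "coord a x = (THE t. x \<ominus> t \<odot> a \<in> complement a)"

lemma coord_eqI:
  assumes a: "atom a" and x: "x \<in> carrier X" and t: "x \<ominus> t \<odot> a \<in> complement a"
  shows "coord a x = t"
  unfolding coord_def
proof (rule the_equality[where P = "\<lambda>t. x \<ominus> t \<odot> a \<in> complement a", OF t])
  note a' = atomD[OF a]
  fix s assume s: "x \<ominus> s \<odot> a \<in> complement a"
  have "(x \<ominus> s \<odot> a) \<oplus> (-1) \<odot> (x \<ominus> t \<odot> a) \<in> complement a"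
    using s t complement_add complement_scale by blast
  also have "(x \<ominus> s \<odot> a) \<oplus> (-1) \<odot> (x \<ominus> t \<odot> a) = (t - s) \<odot> a"
    using a' x by (intro vector_eqI) (auto simp: algebra_simps)
  finally show "s = t" using scale_mem_complement a' by fastforce
qed

lemma coord_nonneg_orthogonal:
  assumes a: "atom a" and x: "x \<in> carrier X" "vle X \<zero> x"
  shows "0 \<le> coord a x \<and> orthogonal (x \<ominus> coord a x \<odot> a) a"
  using atom_split_nonneg[OF assms] coord_eqI[OF a x(1)] orthogonal_imp_complement by metis

text \<open>The splittings of the positive and the negative part are subtracted; the complement is a
  subspace.\<close>

lemma coord_complement:
  assumes a: "atom a" and x: "x \<in> carrier X"
  shows "x \<ominus> coord a x \<odot> a \<in> complement a"
proof -
  note a' = atomD[OF a]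
  obtain p n where pn: "orthogonal p n" "x = p \<ominus> n" using positive_parts[OF x] by metis
  then have C: "p \<in> carrier X" "n \<in> carrier X" "vle X \<zero> p" "vle X \<zero> n" by (auto simp: orthogonal_def)
  have "p \<ominus> coord a p \<odot> a \<in> complement a" "n \<ominus> coord a n \<odot> a \<in> complement a"
    using coord_nonneg_orthogonal[OF a] C orthogonal_imp_complement by auto
  then have "(p \<ominus> coord a p \<odot> a) \<oplus> (-1) \<odot> (n \<ominus> coord a n \<odot> a) \<in> complement a"
    using complement_add complement_scale by blast
  also have "(p \<ominus> coord a p \<odot> a) \<oplus> (-1) \<odot> (n \<ominus> coord a n \<odot> a)
      = x \<ominus> (coord a p - coord a n) \<odot> a"
    using a' C pn by (intro vector_eqI) (auto simp: algebra_simps)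
  finally show ?thesis using coord_eqI[OF a x] by metis
qed

lemma coord_add:
  assumes a: "atom a" and C: "x \<in> carrier X" "y \<in> carrier X"
  shows "coord a (x \<oplus> y) = coord a x + coord a y"
proof (rule coord_eqI[OF a])
  note a' = atomD[OF a]
  have "(x \<ominus> coord a x \<odot> a) \<oplus> (y \<ominus> coord a y \<odot> a) \<in> complement a"
    using complement_add coord_complement a C by blast
  also have "(x \<ominus> coord a x \<odot> a) \<oplus> (y \<ominus> coord a y \<odot> a) = x \<oplus> y \<ominus> (coord a x + coord a y) \<odot> a"
    using a' C by (intro vector_eqI) (auto simp: algebra_simps)
  finally show "x \<oplus> y \<ominus> (coord a x + coord a y) \<odot> a \<in> complement a" .
qed (use C in simp)

lemma coord_scale:
  assumes a: "atom a" and C: "x \<in> carrier X"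
  shows "coord a (t \<odot> x) = t * coord a x"
proof (rule coord_eqI[OF a])
  note a' = atomD[OF a]
  have "t \<odot> (x \<ominus> coord a x \<odot> a) \<in> complement a"
    using complement_scale coord_complement a C by blast
  also have "t \<odot> (x \<ominus> coord a x \<odot> a) = t \<odot> x \<ominus> (t * coord a x) \<odot> a"
    using a' C by (intro vector_eqI) (auto simp: algebra_simps)
  finally show "t \<odot> x \<ominus> (t * coord a x) \<odot> a \<in> complement a" .
qed (use C in simp)

lemma coord_diff:
  assumes a: "atom a" and C: "x \<in> carrier X" "y \<in> carrier X"
  shows "coord a (x \<ominus> y) = coord a x - coord a y"
  using coord_add[OF a, of x "\<ominus> y"] coord_scale[OF a, of y "-1"] C
  by (simp add: M.minus_eq minus_eq_scale)

lemma coord_orthogonal: "atom a \<Longrightarrow> orthogonal x a \<Longrightarrow> coord a x = 0"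
proof (rule coord_eqI)
  assume a: "atom a" and x: "orthogonal x a"
  have "x \<ominus> 0 \<odot> a = x" using atomD[OF a] orthogonal_carrier[OF x] by (intro vector_eqI) auto
  then show "x \<ominus> 0 \<odot> a \<in> complement a" using orthogonal_imp_complement[OF x] by simp
qed (auto simp: orthogonal_def)

lemma coord_self: "atom a \<Longrightarrow> coord a a = 1"
proof (rule coord_eqI)
  assume a: "atom a"
  have "a \<ominus> 1 \<odot> a = \<zero>" using atomD[OF a] by (intro vector_eqI) auto
  then show "a \<ominus> 1 \<odot> a \<in> complement a"
    using orthogonal_imp_complement[OF orthogonal_zero] atomD[OF a] by simp
qed (auto simp: atom_def)

text \<open>Orthogonality of the remainder includes its positivity. This places the components of
  \<open>x\<close> in the interval from zero to \<open>x\<close>, where orthogonal sequences are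
  excluded.\<close>

lemma coord_scale_le:
  assumes a: "atom a" and x: "x \<in> carrier X" "vle X \<zero> x"
  shows "vle X (coord a x \<odot> a) x"
  using coord_nonneg_orthogonal[OF assms] atomD[OF a] x le_iff_diff_nonneg[of "coord a x \<odot> a" x]
  by (simp add: orthogonal_def)

end

section \<open>Lattices with bounded functionals\<close>

context vector_lattice
begin

lemma complement_zero: "\<lbrakk>a \<in> carrier X; vle X \<zero> a\<rbrakk> \<Longrightarrow> \<zero> \<in> complement a"
  by (simp add: orthogonal_imp_complement orthogonal_zero)

text \<open>After \<open>n\<close> steps, the functional on the span of
  \<open>e 0, ..., e (n - 1)\<close> that sends each \<open>e k\<close> to \<open>k\<close>.\<close>

primrec sequence_graph :: "(nat \<Rightarrow> 'a) \<Rightarrow> nat \<Rightarrow> ('a \<times> real) set" where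
  "sequence_graph e 0 = {(\<zero>, 0)}"
| "sequence_graph e (Suc n) = adjoin (sequence_graph e n) (e n) (real n)"

text \<open>Linear independence in the form that \<open>adjoin\<close> asks for: the span of the
  first \<open>n\<close> members stays in the complement of every later member, so
  \<open>e n\<close> is new, as otherwise it would be orthogonal to itself.\<close>

lemma orthogonal_sequence_functional:
  assumes e: "\<And>n. e n \<noteq> \<zero>" "\<And>m n. m \<noteq> n \<Longrightarrow> orthogonal (e m) (e n)"
  obtains f where "f \<in> algebraic_dual X" "\<forall>n. f (e n) = real n"
proof -
  \<comment> \<open>Both facts are part of orthogonality to any other member; \<open>Suc n\<close>
    is merely a different index.\<close>
  have eC: "e n \<in> carrier X" "vle X \<zero> (e n)" for n
    using e(2)[of n "Suc n"] by (auto simp: orthogonal_def)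
  have inv: "linear_graph (sequence_graph e n) \<and>
      (\<forall>m\<ge>n. Domain (sequence_graph e n) \<subseteq> complement (e m))" for n
  proof (induction n)
    case 0
    then show ?case using linear_graph_zero complement_zero eC by auto
  next
    case (Suc n)
    have "e n \<notin> Domain (sequence_graph e n)"
    proof
      assume "e n \<in> Domain (sequence_graph e n)"
      then have "e n \<in> complement (e n)" using Suc by blast
      then show False using complement_imp_orthogonal orthogonal_self eC e(1) by blast
    qed
    then have "linear_graph (sequence_graph e (Suc n))"
      using Suc linear_graph_adjoin eC by simp
    moreover have "Domain (sequence_graph e (Suc n)) \<subseteq> complement (e m)" if m: "Suc n \<le> m" for m
    proof
      fix z assume "z \<in> Domain (sequence_graph e (Suc n))"
      then obtain y s c where y: "z = y \<oplus> c \<odot> e n" "(y, s) \<in> sequence_graph e n"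
        by (auto simp: adjoin_def)
      have "y \<in> complement (e m)" using Suc y(2) m by (meson Domain.DomainI Suc_leD subsetD)
      moreover have "e n \<in> complement (e m)"
        using orthogonal_imp_complement e(2) m by simp
      ultimately show "z \<in> complement (e m)"
        using complement_add complement_scale y(1) by simp
    qed
    ultimately show ?case by blast
  qed
  \<comment> \<open>The graphs increase, so their union is again a graph. It prescribes all the
    values at once and is then extended to the whole space.\<close>
  define M where "M = (\<Union>n. sequence_graph e n)"
  have "mono (sequence_graph e)"
    using subset_adjoin inv eC by (auto simp: mono_iff_le_Suc)
  then have mono: "sequence_graph e m \<subseteq> sequence_graph e n" if "m \<le> n" for m n
    using that by (simp add: monoD)
  have "linear_graph M"
    unfolding linear_graph_def
  proof (intro conjI allI impI)
    show "M \<subseteq> carrier X \<times> UNIV" using inv unfolding linear_graph_def M_def by blast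
    show "(\<zero>, 0) \<in> M" using inv[of 0] unfolding linear_graph_def M_def by blast
    show "(a \<odot> y, a * s) \<in> M" if "(y, s) \<in> M" for y s a
      using inv that unfolding linear_graph_def M_def by blast
    show "t = 0" if "(\<zero>, t) \<in> M" for t
      using inv that unfolding linear_graph_def M_def by blast
    fix x s y t assume "(x, s) \<in> M" "(y, t) \<in> M"
    then obtain m n where mn: "(x, s) \<in> sequence_graph e m" "(y, t) \<in> sequence_graph e n"
      unfolding M_def by blast
    then have "(x, s) \<in> sequence_graph e (max m n)" "(y, t) \<in> sequence_graph e (max m n)"
      using mono[of m "max m n"] mono[of n "max m n"] by auto
    then have "(x \<oplus> y, s + t) \<in> sequence_graph e (max m n)"
      using inv[of "max m n"] unfolding linear_graph_def by blast
    then show "(x \<oplus> y, s + t) \<in> M" unfolding M_def by blast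
  qed
  then obtain f where f: "f \<in> algebraic_dual X" "\<And>x t. (x, t) \<in> M \<Longrightarrow> f x = t"
    using linear_graph_extends by blast
  have "(e n, real n) \<in> M" for n
    using mem_adjoin[of "sequence_graph e n" "e n" "real n"] inv eC
    unfolding M_def by (metis UN_I UNIV_I sequence_graph.simps(2))
  then have "\<forall>n. f (e n) = real n" using f(2) by blast
  with f(1) show thesis by (rule that)
qed

lemma order_dual_bounded_above:
  assumes f: "f \<in> order_dual X" and x: "x \<in> carrier X"
  obtains b where "\<And>y. \<lbrakk>y \<in> carrier X; vle X \<zero> y; vle X y x\<rbrakk> \<Longrightarrow> f y \<le> b"
proof -
  have "order_bounded X \<lbrace>\<zero>..x\<rbrace>\<^bsub>vorder X\<^esub>" using x by (auto simp: order_bounded_def)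
  then have "order_bounded real_vlat (f ` \<lbrace>\<zero>..x\<rbrace>\<^bsub>vorder X\<^esub>)"
    using f by (simp add: order_bounded_ops_def)
  then obtain l b where "f ` \<lbrace>\<zero>..x\<rbrace>\<^bsub>vorder X\<^esub> \<subseteq> \<lbrace>l..b\<rbrace>\<^bsub>vorder real_vlat\<^esub>"
    by (auto simp: order_bounded_def)
  then have "f y \<le> b" if "y \<in> carrier X" "vle X \<zero> y" "vle X y x" for y
    using that by (auto simp: at_least_at_most_def real_vlat_def)
  then show thesis by (rule that)
qed

lemma no_orthogonal_sequence:
  fixes e :: "nat \<Rightarrow> 'a"
  assumes dual: "order_dual X = algebraic_dual X" and x: "x \<in> carrier X"
    and e: "\<And>n. e n \<noteq> \<zero>" "\<And>m n. m \<noteq> n \<Longrightarrow> orthogonal (e m) (e n)" "\<And>n. vle X (e n) x"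
  shows False
proof -
  obtain f where f: "f \<in> algebraic_dual X" "\<forall>n. f (e n) = real n"
    by (rule orthogonal_sequence_functional[OF e(1,2)])
  have "f \<in> order_dual X" using f(1) dual by simp
  then obtain b where b: "\<And>y. \<lbrakk>y \<in> carrier X; vle X \<zero> y; vle X y x\<rbrakk> \<Longrightarrow> f y \<le> b"
    using order_dual_bounded_above x by blast
  have "e n \<in> carrier X" "vle X \<zero> (e n)" for n
    using e(2)[of n "Suc n"] by (auto simp: orthogonal_def)
  then have "real n \<le> b" for n using b[of "e n"] e(3) f(2) by simp
  then show False using reals_Archimedean2[of b] by (meson not_less)
qed

end

section \<open>Existence of atoms, and a complete orthogonal family of them\<close>

context archimedean_vector_lattice
begin

text \<open>Let \<open>y\<close> between zero and \<open>u\<close> not be a multiple of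
  \<open>u\<close>. Some multiple \<open>t u\<close> is incomparable with \<open>y\<close>, so the
  positive and negative parts of \<open>y - t u\<close> are both nonzero. They are orthogonal, and
  \<open>0 \<le> t \<le> 1\<close> keeps them below \<open>u\<close>.\<close>

lemma not_atom_split:
  assumes u: "u \<in> carrier X" "vle X \<zero> u" "u \<noteq> \<zero>" and na: "\<not> atom u"
  obtains d d' where "orthogonal d d'" "d \<noteq> \<zero>" "d' \<noteq> \<zero>" "vle X d u" "vle X d' u"
proof -
  obtain y where y: "y \<in> carrier X" "vle X \<zero> y" "vle X y u" "\<And>t. y \<noteq> t \<odot> u"
    using u na by (auto simp: atom_def)
  \<comment> \<open>Were every multiple comparable with \<open>y\<close>, the supremum of the
    coefficients of those below \<open>y\<close> would give a multiple below \<open>y\<close>, while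
    every larger multiple lies above \<open>y\<close>. Letting the excess tend to zero would make
    \<open>y\<close> equal to that multiple.\<close>
  have "\<exists>t. \<not> vle X (t \<odot> u) y \<and> \<not> vle X y (t \<odot> u)"
  proof (rule ccontr)
    assume "\<nexists>t. \<not> vle X (t \<odot> u) y \<and> \<not> vle X y (t \<odot> u)"
    then have comp: "vle X (t \<odot> u) y \<or> vle X y (t \<odot> u)" for t by blast
    let ?S = "{t. vle X (t \<odot> u) y}"
    obtain b where "\<And>s. vle X (s \<odot> u) y \<Longrightarrow> s \<le> b" using scale_bounded_above u y by blast
    then have bdd: "bdd_above ?S" by (auto simp: bdd_above_def)
    have "0 \<in> ?S" using u y by simp
    then have le: "vle X (Sup ?S \<odot> u) y"
      by (intro scale_sup_le[OF u(1,2) y(1) _ bdd]) auto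
    have "vle X (y \<ominus> Sup ?S \<odot> u) \<zero>"
    proof (rule le_zero_if_infinitesimal[of _ u])
      fix e :: real assume e: "0 < e"
      have "Sup ?S + e \<notin> ?S" using cSup_upper[OF _ bdd, of "Sup ?S + e"] e by auto
      then have "vle X y ((Sup ?S + e) \<odot> u)" using comp by blast
      then show "vle X (y \<ominus> Sup ?S \<odot> u) (e \<odot> u)"
        by (intro le_scaled[of "y \<ominus> Sup ?S \<odot> u" "e \<odot> u" y "(Sup ?S + e) \<odot> u" 1])
          (use u y in \<open>auto simp: algebra_simps\<close>)
    qed (use u y in auto)
    then have "vle X y (Sup ?S \<odot> u)"
      by (intro le_scaled[of y "Sup ?S \<odot> u" "y \<ominus> Sup ?S \<odot> u" "\<zero>" 1]) (use u y in auto)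
    then show False using le y le_antisym u by blast
  qed
  then obtain t where t: "\<not> vle X (t \<odot> u) y" "\<not> vle X y (t \<odot> u)" by blast
  have "0 \<le> t"
  proof (rule ccontr)
    assume "\<not> 0 \<le> t"
    then have "vle X (t \<odot> u) y"
      by (intro le_combination[of "t \<odot> u" y "\<zero>" u "\<zero>" y "- t" 1]) (use u y in auto)
    then show False using t by simp
  qed
  have "t \<le> 1"
  proof (rule ccontr)
    assume "\<not> t \<le> 1"
    then have "vle X y (t \<odot> u)"
      by (intro le_combination[of y "t \<odot> u" "\<zero>" u y u "t - 1" 1])
        (use u y in \<open>auto simp: algebra_simps\<close>)
    then show False using t by simp
  qed
  have z: "y \<ominus> t \<odot> u \<in> carrier X" using u y by simp
  obtain d d' where d: "orthogonal d d'" "y \<ominus> t \<odot> u = d \<ominus> d'" "vle X (y \<ominus> t \<odot> u) d"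
    and least: "\<forall>v\<in>carrier X. vle X (y \<ominus> t \<odot> u) v \<longrightarrow> vle X \<zero> v \<longrightarrow> vle X d v"
    by (rule positive_parts[OF z])
  have dC: "d \<in> carrier X" "d' \<in> carrier X" using d by (auto simp: orthogonal_def)
  have d'_eq: "d' = d \<ominus> (y \<ominus> t \<odot> u)" unfolding d(2) using dC by (intro vector_eqI) auto
  have "vle X (y \<ominus> t \<odot> u) u"
    by (rule le_combination[of _ _ y u "\<zero>" u 1 t]) (use u y \<open>0 \<le> t\<close> in auto)
  then have du: "vle X d u" using least u by simp
  \<comment> \<open>This is \<open>d' \<le> u\<close> rewritten, so leastness of \<open>d\<close>
    applies. The right side is \<open>y + (1 - t) u\<close>, which is positive because
    \<open>t \<le> 1\<close>.\<close>
  have "vle X d (u \<oplus> (y \<ominus> t \<odot> u))"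
  proof (rule least[rule_format])
    show "vle X (y \<ominus> t \<odot> u) (u \<oplus> (y \<ominus> t \<odot> u))"
      by (rule le_scaled[of _ _ "\<zero>" u 1]) (use u y in auto)
    show "vle X \<zero> (u \<oplus> (y \<ominus> t \<odot> u))"
      by (rule le_combination[of _ _ "\<zero>" y "\<zero>" u 1 "1 - t"])
        (use u y \<open>t \<le> 1\<close> in \<open>auto simp: algebra_simps\<close>)
  qed (use u y in simp)
  then have d'u: "vle X d' u" unfolding d'_eq
    by (intro le_scaled[of "d \<ominus> (y \<ominus> t \<odot> u)" u d "u \<oplus> (y \<ominus> t \<odot> u)" 1]) (use u y dC in auto)
  have "d \<noteq> \<zero>"
  proof
    assume "d = \<zero>"
    then have "vle X y (t \<odot> u)"
      by (intro le_scaled[of y "t \<odot> u" "y \<ominus> t \<odot> u" d 1]) (use u y d(3) in auto)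
    then show False using t by simp
  qed
  moreover have "d' \<noteq> \<zero>"
  proof
    assume d': "d' = \<zero>"
    have "d \<ominus> d' = d" using d' dC by (intro vector_eqI) auto
    then have "vle X (t \<odot> u) y"
      using le_iff_diff_nonneg[of "t \<odot> u" y] u y d by (simp add: orthogonal_def)
    then show False using t by simp
  qed
  ultimately show thesis using that d du d'u by blast
qed

text \<open>Without atoms below \<open>x\<close>, splitting never ends: \<open>U\<close> follows the
  second pieces and \<open>e\<close> collects the first ones, which form a forbidden orthogonal
  sequence.\<close>

lemma atom_below:
  assumes dual: "order_dual X = algebraic_dual X"
    and x: "x \<in> carrier X" "vle X \<zero> x" "x \<noteq> \<zero>"
  obtains b where "atom b" "vle X b x"
proof (rule ccontr)
  assume "\<not> thesis"
  then have no: "\<not> (atom b \<and> vle X b x)" for b using that by blast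
  define Q where "Q u \<longleftrightarrow> u \<in> carrier X \<and> vle X \<zero> u \<and> u \<noteq> \<zero> \<and> vle X u x" for u
  have "\<exists>p. orthogonal (fst p) (snd p) \<and> fst p \<noteq> \<zero> \<and> snd p \<noteq> \<zero> \<and> vle X (fst p) u \<and> vle X (snd p) u"
    if "Q u" for u
  proof -
    have "\<not> atom u" using no that \<open>Q u\<close> by (auto simp: Q_def)
    then obtain d d' where "orthogonal d d'" "d \<noteq> \<zero>" "d' \<noteq> \<zero>" "vle X d u" "vle X d' u"
      using not_atom_split \<open>Q u\<close> unfolding Q_def by metis
    then show ?thesis by (intro exI[of _ "(d, d')"]) simp
  qed
  then obtain g where g: "\<And>u. Q u \<Longrightarrow> orthogonal (fst (g u)) (snd (g u)) \<and> fst (g u) \<noteq> \<zero> \<and>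
      snd (g u) \<noteq> \<zero> \<and> vle X (fst (g u)) u \<and> vle X (snd (g u)) u"
    by metis
  define U where "U n = ((\<lambda>u. snd (g u)) ^^ n) x" for n
  have US: "U (Suc n) = snd (g (U n))" for n by (simp add: U_def)
  have Q: "Q (U n)" for n
  proof (induction n)
    case 0 then show ?case using x by (simp add: U_def Q_def)
  next
    case (Suc n)
    then show ?case using g[OF Suc] le_trans[of "U (Suc n)" "U n" x] x(1)
      by (auto simp: US Q_def orthogonal_def)
  qed
  have C: "U n \<in> carrier X" "vle X \<zero> (U n)" "vle X (U n) x" for n using Q by (auto simp: Q_def)
  have dec: "vle X (U (m + k)) (U m)" for m k
  proof (induction k)
    case (Suc k)
    have "vle X (U (Suc (m + k))) (U (m + k))" using g[OF Q] by (simp add: US)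
    then show ?case using Suc le_trans C by (metis add_Suc_right)
  qed (use C in simp)
  define e where "e n = fst (g (U n))" for n
  have e: "e n \<noteq> \<zero>" "e n \<in> carrier X" "vle X \<zero> (e n)" "vle X (e n) (U n)"
    "orthogonal (e n) (U (Suc n))" for n
    using g[OF Q[of n]] by (auto simp: e_def US orthogonal_def)
  \<comment> \<open>The piece \<open>e m\<close> is orthogonal to \<open>U (Suc m)\<close>, and
    since \<open>U\<close> decreases every later \<open>e n\<close> lies below that element.\<close>
  have lt: "orthogonal (e m) (e n)" if mn: "m < n" for m n
  proof -
    obtain k where "n = Suc m + k" using less_imp_Suc_add[OF mn] by auto
    then have "vle X (U n) (U (Suc m))" using dec by blast
    then have "vle X (e n) (U (Suc m))" using e C le_trans by blast
    then show ?thesis using e orthogonal_mono orthogonal_sym by blast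
  qed
  show False
  proof (rule no_orthogonal_sequence[OF dual x(1)])
    show "orthogonal (e m) (e n)" if "m \<noteq> n" for m n
      using lt orthogonal_sym that by (metis linorder_neqE_nat)
    show "vle X (e n) x" for n using e C le_trans x by blast
  qed (rule e)
qed

text \<open>For positive \<open>u\<close> the components along atoms with nonzero coordinate are
  nonzero, pairwise orthogonal and below \<open>u\<close>; infinitely many of them would again be a
  forbidden sequence. A general \<open>x\<close> is treated through its two parts.\<close>

lemma finite_support:
  assumes dual: "order_dual X = algebraic_dual X"
    and A: "\<And>a. a \<in> A \<Longrightarrow> atom a" "\<And>a b. \<lbrakk>a \<in> A; b \<in> A; a \<noteq> b\<rbrakk> \<Longrightarrow> orthogonal a b"
    and x: "x \<in> carrier X"
  shows "finite {a \<in> A. coord a x \<noteq> 0}"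
proof -
  have pos: "finite {a \<in> A. coord a u \<noteq> 0}" if u: "u \<in> carrier X" "vle X \<zero> u" for u
  proof (rule ccontr)
    assume "infinite {a \<in> A. coord a u \<noteq> 0}"
    then obtain h :: "nat \<Rightarrow> 'a" where h: "inj h" "range h \<subseteq> {a \<in> A. coord a u \<noteq> 0}"
      using infinite_countable_subset by blast
    then have hA: "h n \<in> A" "coord (h n) u \<noteq> 0" for n by auto
    define e where "e n = coord (h n) u \<odot> h n" for n
    have nn: "0 \<le> coord (h n) u" for n using coord_nonneg_orthogonal A(1) hA u by blast
    show False
    proof (rule no_orthogonal_sequence[OF dual u(1)])
      show "e n \<noteq> \<zero>" for n
        using scale_eq_zero_imp[of "h n" "coord (h n) u"] atomD(1,2)[OF A(1)[OF hA(1)]] hA(2)[of n]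
        unfolding e_def by blast
      show "vle X (e n) u" for n using coord_scale_le A(1) hA u by (simp add: e_def)
      show "orthogonal (e m) (e n)" if "m \<noteq> n" for m n
      proof -
        have "orthogonal (h m) (h n)" using A(2) hA h(1) that by (metis injD)
        then show ?thesis using orthogonal_scale orthogonal_sym nn unfolding e_def by meson
      qed
    qed
  qed
  obtain p n where pn: "orthogonal p n" "x = p \<ominus> n" using positive_parts[OF x] by metis
  then have "finite ({a \<in> A. coord a p \<noteq> 0} \<union> {a \<in> A. coord a n \<noteq> 0})"
    using pos by (auto simp: orthogonal_def)
  moreover have "{a \<in> A. coord a x \<noteq> 0} \<subseteq> {a \<in> A. coord a p \<noteq> 0} \<union> {a \<in> A. coord a n \<noteq> 0}"
    using pn A(1) coord_diff orthogonal_carrier by auto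
  ultimately show ?thesis by (rule rev_finite_subset)
qed

text \<open>A nonzero common positive lower bound is a multiple of each of the two atoms.\<close>

lemma atoms_proportional:
  assumes a: "atom a" and b: "atom b" and no: "\<not> orthogonal a b"
  obtains t where "t \<noteq> 0" "b = t \<odot> a"
proof -
  obtain w where w: "w \<in> carrier X" "vle X \<zero> w" "vle X w a" "vle X w b" "w \<noteq> \<zero>"
    using no atomD[OF a] atomD[OF b] by (auto simp: orthogonal_def)
  obtain s r where s: "w = s \<odot> a" "w = r \<odot> b" using w a b unfolding atom_def by meson
  have "r \<noteq> 0" "s \<noteq> 0" using s w atomD[OF a] atomD[OF b] by auto
  moreover have "b = inverse r \<odot> (r \<odot> b)" using atomD[OF b] \<open>r \<noteq> 0\<close> by (simp add: scale_scale)
  then have "b = (inverse r * s) \<odot> a" using s atomD[OF a] by (metis scale_scale)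
  ultimately show thesis using that[of "inverse r * s"] by simp
qed

text \<open>A maximal orthogonal family holds one atom from each class of proportional atoms. An
  atom orthogonal to all members could be inserted, so by maximality it would be a member, hence
  orthogonal to itself.\<close>

lemma atom_representatives:
  obtains A where "\<And>a. a \<in> A \<Longrightarrow> atom a"
    "\<And>a b. \<lbrakk>a \<in> A; b \<in> A; a \<noteq> b\<rbrakk> \<Longrightarrow> orthogonal a b"
    "\<And>b. atom b \<Longrightarrow> \<exists>a\<in>A. \<not> orthogonal b a"
proof -
  let ?S = "{A. (\<forall>a\<in>A. atom a) \<and> (\<forall>a\<in>A. \<forall>b\<in>A. a \<noteq> b \<longrightarrow> orthogonal a b)}"
  have "\<exists>M\<in>?S. \<forall>N\<in>?S. M \<subseteq> N \<longrightarrow> N = M"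
  proof (rule subset_Zorn_nonempty)
    show "?S \<noteq> {}" by auto
    fix \<C> assume ch: "subset.chain ?S \<C>"
    have "orthogonal a b" if ab: "a \<in> \<Union>\<C>" "b \<in> \<Union>\<C>" "a \<noteq> b" for a b
    proof -
      obtain M N where MN: "M \<in> \<C>" "N \<in> \<C>" "a \<in> M" "b \<in> N" using ab by blast
      then have "M \<subseteq> N \<or> N \<subseteq> M" using ch by (auto simp: subset_chain_def)
      then obtain L where "L \<in> \<C>" "a \<in> L" "b \<in> L" using MN by blast
      moreover have "L \<in> ?S" using ch \<open>L \<in> \<C>\<close> by (auto simp: subset_chain_def)
      ultimately show ?thesis using ab(3) by blast
    qed
    moreover have "atom a" if "a \<in> \<Union>\<C>" for a using ch that by (auto simp: subset_chain_def)
    ultimately show "\<Union>\<C> \<in> ?S" by blast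
  qed
  then obtain M where M: "M \<in> ?S" "\<And>N. N \<in> ?S \<Longrightarrow> M \<subseteq> N \<Longrightarrow> N = M" by auto
  have "\<exists>a\<in>M. \<not> orthogonal b a" if b: "atom b" for b
  proof (rule ccontr)
    assume n: "\<not> (\<exists>a\<in>M. \<not> orthogonal b a)"
    then have "insert b M \<in> ?S" using M(1) b orthogonal_sym by auto
    then have "insert b M = M" by (rule M(2)) auto
    then have "orthogonal b b" using n by blast
    then show False using orthogonal_self atomD(2)[OF b] by blast
  qed
  then show thesis using M(1) by (intro that[of M]) auto
qed

text \<open>Everything reduces to positivity of \<open>z = y - x\<close>. A nonzero negative part
  \<open>n\<close> dominates an atom \<open>b = t a\<close> with \<open>a\<close> in the family and
  \<open>t > 0\<close>. The positive part has coordinate 0 along \<open>a\<close>, while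
  \<open>n\<close> has at least \<open>t\<close>, so the coordinate of \<open>z\<close> is
  negative.\<close>

lemma le_iff_coords_le:
  assumes dual: "order_dual X = algebraic_dual X"
    and A: "\<And>a. a \<in> A \<Longrightarrow> atom a" "\<And>b. atom b \<Longrightarrow> \<exists>a\<in>A. \<not> orthogonal b a"
    and C: "x \<in> carrier X" "y \<in> carrier X"
  shows "vle X x y \<longleftrightarrow> (\<forall>a\<in>A. coord a x \<le> coord a y)"
proof -
  define z where "z = y \<ominus> x"
  have z: "z \<in> carrier X" using C by (simp add: z_def)
  have "vle X \<zero> z \<longleftrightarrow> (\<forall>a\<in>A. 0 \<le> coord a z)"
  proof
    assume "vle X \<zero> z"
    then show "\<forall>a\<in>A. 0 \<le> coord a z" using coord_nonneg_orthogonal A(1) z by blast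
  next
    assume nn: "\<forall>a\<in>A. 0 \<le> coord a z"
    obtain p n where pn: "orthogonal p n" "z = p \<ominus> n" using positive_parts[OF z] by metis
    then have pnC: "p \<in> carrier X" "n \<in> carrier X" "vle X \<zero> p" "vle X \<zero> n"
      by (auto simp: orthogonal_def)
    have "n = \<zero>"
    proof (rule ccontr)
      assume "n \<noteq> \<zero>"
      then obtain b where b: "atom b" "vle X b n" using atom_below[OF dual] pnC by blast
      obtain a where a: "a \<in> A" "\<not> orthogonal b a" using A(2)[OF b(1)] by blast
      note a' = atomD[OF A(1)[OF a(1)]] and b' = atomD[OF b(1)]
      obtain t where t: "t \<noteq> 0" "b = t \<odot> a"
        using atoms_proportional[OF A(1)[OF a(1)] b(1)] a(2) orthogonal_sym by blast
      then have "0 < t" using b' scale_nonneg_iff a' by fastforce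
      have pb: "orthogonal p b" using pn(1) b b' orthogonal_mono orthogonal_sym by blast
      have "a = inverse t \<odot> b" using t a' by (simp add: scale_scale)
      then have "orthogonal p a"
        using orthogonal_scale[OF orthogonal_sym[OF pb], of "inverse t"] \<open>0 < t\<close> orthogonal_sym by simp
      then have p0: "coord a p = 0" using coord_orthogonal A(1) a(1) by blast
      \<comment> \<open>The coordinate of the positive element \<open>n - b\<close> is
        \<open>coord a n - t\<close>; this gives the lower bound \<open>t\<close>.\<close>
      have "0 \<le> coord a (n \<ominus> b)"
        using coord_nonneg_orthogonal A(1) a(1) b b' pnC le_iff_diff_nonneg[of b n] by auto
      moreover have "coord a (n \<ominus> b) = coord a n - t"
        using coord_diff coord_scale coord_self A(1) a(1) t(2) pnC b' a' by simp
      ultimately have "0 < coord a n" using \<open>0 < t\<close> by linarith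
      moreover have "coord a z = coord a p - coord a n"
        using coord_diff[OF A(1)[OF a(1)]] pn pnC by simp
      ultimately show False using nn a(1) p0 by force
    qed
    then have "z = p" using pn pnC by (intro vector_eqI) auto
    then show "vle X \<zero> z" using pnC by simp
  qed
  then show ?thesis
    using C coord_diff[OF A(1)] le_iff_diff_nonneg[of x y] by (simp add: z_def)
qed

text \<open>The witness is the sum of \<open>h a\<close> times \<open>a\<close> over
  \<open>F\<close>: a member of the family has coordinate 1 along itself and 0 along the
  others.\<close>

lemma coords_surj:
  assumes A: "\<And>a. a \<in> A \<Longrightarrow> atom a" "\<And>a b. \<lbrakk>a \<in> A; b \<in> A; a \<noteq> b\<rbrakk> \<Longrightarrow> orthogonal a b"
    and F: "finite F" "F \<subseteq> A"
  shows "\<exists>x\<in>carrier X. \<forall>a\<in>A. coord a x = (if a \<in> F then h a else 0)"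
  using F
proof (induction F)
  case empty
  have "coord a \<zero> = 0" if "a \<in> A" for a
    using coord_scale[OF A(1)[OF that], of "\<zero>" 0] by simp
  then show ?case by auto
next
  case (insert b F)
  then obtain x where x: "x \<in> carrier X" "\<forall>a\<in>A. coord a x = (if a \<in> F then h a else 0)" by auto
  have b: "b \<in> A" "b \<in> carrier X" using insert.prems A(1) atomD(1) by auto
  have cb: "coord a b = (if a = b then 1 else 0)" if "a \<in> A" for a
    using coord_self coord_orthogonal A b that by auto
  have "coord a (x \<oplus> h b \<odot> b) = (if a \<in> insert b F then h a else 0)" if "a \<in> A" for a
    using coord_add[OF A(1)[OF that], of x "h b \<odot> b"] coord_scale[OF A(1)[OF that], of b "h b"]
      x b cb[OF that] insert.hyps that by auto
  then show ?case using x b by (intro bexI[of _ "x \<oplus> h b \<odot> b"]) auto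
qed

end

section \<open>Isomorphism with finitely supported functions\<close>

lemma c00_simps [simp]:
  "f \<in> carrier (c00 \<Lambda>) \<longleftrightarrow> (\<forall>i. i \<notin> \<Lambda> \<longrightarrow> f i = 0) \<and> finite {i. f i \<noteq> 0}"
  "f \<oplus>\<^bsub>c00 \<Lambda>\<^esub> g = (\<lambda>i. f i + g i)" "\<zero>\<^bsub>c00 \<Lambda>\<^esub> = (\<lambda>i. 0)"
  "a \<odot>\<^bsub>c00 \<Lambda>\<^esub> f = (\<lambda>i. a * f i)" "vle (c00 \<Lambda>) f g \<longleftrightarrow> (\<forall>i\<in>\<Lambda>. f i \<le> g i)"
  by (auto simp: c00_def)

section \<open>Order isomorphisms versus lattice isomorphisms\<close>

lemma (in vector_lattice) join_eq_iff:
  assumes "x \<in> carrier X" "y \<in> carrier X"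
  shows "x \<squnion>\<^bsub>vorder X\<^esub> y = y \<longleftrightarrow> vle X x y"
proof
  assume "x \<squnion>\<^bsub>vorder X\<^esub> y = y"
  then show "vle X x y" using order.join_left[of x y] assms by simp
next
  assume "vle X x y"
  then show "x \<squnion>\<^bsub>vorder X\<^esub> y = y"
    using order.join_right[of x y] order.join_le[of x y y] order.join_closed[of x y] assms
    by (intro le_antisym) auto
qed

lemma lattice_isomorphicI:
  assumes X: "vector_lattice X" and Y: "vector_lattice Y"
    and T: "T \<in> linear_ops X Y" "bij_betw T (carrier X) (carrier Y)"
    and le: "\<And>x y. \<lbrakk>x \<in> carrier X; y \<in> carrier X\<rbrakk> \<Longrightarrow> vle Y (T x) (T y) \<longleftrightarrow> vle X x y"
  shows "lattice_isomorphic X Y"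
proof -
  interpret X: vector_lattice X by (rule X)
  interpret Y: vector_lattice Y by (rule Y)
  have TC: "T x \<in> carrier Y" if "x \<in> carrier X" for x using T(2) that by (auto simp: bij_betw_def)
  have "T (x \<squnion>\<^bsub>vorder X\<^esub> y) = T x \<squnion>\<^bsub>vorder Y\<^esub> T y"
    if x: "x \<in> carrier X" and y: "y \<in> carrier X" for x y
  proof (rule Y.le_antisym)
    let ?j = "x \<squnion>\<^bsub>vorder X\<^esub> y" and ?k = "T x \<squnion>\<^bsub>vorder Y\<^esub> T y"
    have j: "?j \<in> carrier X" "vle X x ?j" "vle X y ?j"
      using X.order.join_closed[of x y] X.order.join_left[of x y] X.order.join_right[of x y] x y by auto
    have k: "?k \<in> carrier Y" "vle Y (T x) ?k" "vle Y (T y) ?k"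
      using Y.order.join_closed[of "T x" "T y"] Y.order.join_left[of "T x" "T y"]
        Y.order.join_right[of "T x" "T y"] TC[OF x] TC[OF y] by auto
    \<comment> \<open>Surjectivity pulls the join of the images back to an upper bound of
      \<open>x\<close> and \<open>y\<close>, which therefore dominates their join.\<close>
    obtain z where z: "z \<in> carrier X" "?k = T z" using k(1) T(2) by (auto simp: bij_betw_def)
    have "vle X ?j z" using X.order.join_le[of x z y] x y z k le by auto
    then show "vle Y (T ?j) ?k" using le j z by simp
    show "vle Y ?k (T ?j)"
      using Y.order.join_le[of "T x" "T ?j" "T y"] j x y le TC by simp
    show "T ?j \<in> carrier Y" "?k \<in> carrier Y" using TC j k by auto
  qed
  moreover have "T (x \<sqinter>\<^bsub>vorder X\<^esub> y) = T x \<sqinter>\<^bsub>vorder Y\<^esub> T y"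
    if x: "x \<in> carrier X" and y: "y \<in> carrier X" for x y
  proof (rule Y.le_antisym)
    let ?j = "x \<sqinter>\<^bsub>vorder X\<^esub> y" and ?k = "T x \<sqinter>\<^bsub>vorder Y\<^esub> T y"
    have j: "?j \<in> carrier X" "vle X ?j x" "vle X ?j y"
      using X.order.meet_closed[of x y] X.order.meet_left[of x y] X.order.meet_right[of x y] x y by auto
    have k: "?k \<in> carrier Y" "vle Y ?k (T x)" "vle Y ?k (T y)"
      using Y.order.meet_closed[of "T x" "T y"] Y.order.meet_left[of "T x" "T y"]
        Y.order.meet_right[of "T x" "T y"] TC[OF x] TC[OF y] by auto
    obtain z where z: "z \<in> carrier X" "?k = T z" using k(1) T(2) by (auto simp: bij_betw_def)
    have "vle X z ?j" using X.order.meet_le[of z x y] x y z k le by auto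
    then show "vle Y ?k (T ?j)" using le j z by simp
    show "vle Y (T ?j) ?k"
      using Y.order.meet_le[of "T ?j" "T x" "T y"] j x y le TC by simp
    show "T ?j \<in> carrier Y" "?k \<in> carrier Y" using TC j k by auto
  qed
  ultimately show ?thesis using T unfolding lattice_isomorphic_def by blast
qed

text \<open>The relation \<open>x \<le> y\<close> says that the join of \<open>x\<close> and
  \<open>y\<close> is \<open>y\<close>; an injective map that preserves joins also reflects this
  equation.\<close>

lemma lattice_isomorphicE:
  assumes X: "vector_lattice X" and Y: "vector_lattice Y" and iso: "lattice_isomorphic X Y"
  obtains T where "T \<in> linear_ops X Y" "bij_betw T (carrier X) (carrier Y)"
    "\<forall>x\<in>carrier X. \<forall>y\<in>carrier X. vle Y (T x) (T y) \<longleftrightarrow> vle X x y"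
proof -
  interpret X: vector_lattice X by (rule X)
  interpret Y: vector_lattice Y by (rule Y)
  obtain T where T: "T \<in> linear_ops X Y" "bij_betw T (carrier X) (carrier Y)"
    and j: "\<forall>x\<in>carrier X. \<forall>y\<in>carrier X. T (x \<squnion>\<^bsub>vorder X\<^esub> y) = T x \<squnion>\<^bsub>vorder Y\<^esub> T y"
    using iso by (auto simp: lattice_isomorphic_def)
  have "vle Y (T x) (T y) \<longleftrightarrow> vle X x y" if "x \<in> carrier X" "y \<in> carrier X" for x y
  proof -
    have C: "T x \<in> carrier Y" "T y \<in> carrier Y" "x \<squnion>\<^bsub>vorder X\<^esub> y \<in> carrier X"
      using T(2) that X.order.join_closed[of x y] by (auto simp: bij_betw_def)
    have "vle Y (T x) (T y) \<longleftrightarrow> T (x \<squnion>\<^bsub>vorder X\<^esub> y) = T y"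
      using Y.join_eq_iff[OF C(1,2)] j that by simp
    also have "\<dots> \<longleftrightarrow> x \<squnion>\<^bsub>vorder X\<^esub> y = y"
      using T(2) C(3) that by (auto simp: bij_betw_def inj_on_def)
    finally show ?thesis using X.join_eq_iff that by simp
  qed
  then show thesis using T that by blast
qed

text \<open>The index set is the complete orthogonal family of atoms, relabelled by
  \<open>emb\<close> so that it lives in the universe type.\<close>

lemma (in archimedean_vector_lattice) isomorphic_c00_if_order_dual_eq:
  fixes emb :: "'a \<Rightarrow> 'u"
  assumes dual: "order_dual X = algebraic_dual X"
    and nonzero: "carrier X \<noteq> {\<zero>}" and emb: "inj_on emb (carrier X)"
  shows "\<exists>\<Lambda>::'u set. \<Lambda> \<noteq> {} \<and> lattice_isomorphic X (c00 \<Lambda>)"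
proof -
  obtain A where A: "\<And>a. a \<in> A \<Longrightarrow> atom a"
    "\<And>a b. \<lbrakk>a \<in> A; b \<in> A; a \<noteq> b\<rbrakk> \<Longrightarrow> orthogonal a b"
    "\<And>b. atom b \<Longrightarrow> \<exists>a\<in>A. \<not> orthogonal b a"
    using atom_representatives by blast
  have AC: "A \<subseteq> carrier X" using A(1) atomD(1) by blast
  then have inj: "inj_on emb A" using emb inj_on_subset by blast
  define \<Lambda> where "\<Lambda> = emb ` A"
  have le_iff: "vle X x y \<longleftrightarrow> (\<forall>a\<in>A. coord a x \<le> coord a y)"
    if "x \<in> carrier X" "y \<in> carrier X" for x y
    using le_iff_coords_le[OF dual _ _ that] A by blast
  define T where "T = restrict (\<lambda>x i. if i \<in> \<Lambda> then coord (inv_into A emb i) x else 0) (carrier X)"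
  have T_emb: "T x (emb a) = coord a x" if "x \<in> carrier X" "a \<in> A" for x a
    using that inj by (simp add: T_def \<Lambda>_def)
  have T_out: "T x i = 0" if "x \<in> carrier X" "i \<notin> \<Lambda>" for x i
    using that by (simp add: T_def)
  have fun_eqI: "g = h" if gh: "\<And>i. i \<notin> \<Lambda> \<Longrightarrow> g i = h i" "\<And>a. a \<in> A \<Longrightarrow> g (emb a) = h (emb a)"
    for g h :: "'u \<Rightarrow> real"
  proof
    fix i show "g i = h i" using gh by (cases "i \<in> \<Lambda>") (auto simp: \<Lambda>_def)
  qed
  have T_C: "T x \<in> carrier (c00 \<Lambda>)" if x: "x \<in> carrier X" for x
  proof -
    have "{i. T x i \<noteq> 0} \<subseteq> emb ` {a \<in> A. coord a x \<noteq> 0}"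
    proof
      fix i assume i: "i \<in> {i. T x i \<noteq> 0}"
      then have "i \<in> \<Lambda>" using T_out[OF x, of i] by blast
      then obtain a where "a \<in> A" "i = emb a" by (auto simp: \<Lambda>_def)
      then show "i \<in> emb ` {a \<in> A. coord a x \<noteq> 0}" using i T_emb[OF x] by auto
    qed
    moreover have "finite {a \<in> A. coord a x \<noteq> 0}" by (rule finite_support[OF dual A(1,2) x])
    ultimately have "finite {i. T x i \<noteq> 0}" by (meson finite_imageI finite_subset)
    then show ?thesis using T_out[OF x] by simp
  qed
  have T_lin: "T \<in> linear_ops X (c00 \<Lambda>)"
    unfolding linear_ops_def
  proof (intro CollectI conjI ballI allI)
    show "T \<in> carrier X \<rightarrow>\<^sub>E carrier (c00 \<Lambda>)"
      using T_C by (intro PiE_I) (auto simp: T_def)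
    fix x assume x: "x \<in> carrier X"
    show "T (x \<oplus> y) = T x \<oplus>\<^bsub>c00 \<Lambda>\<^esub> T y" if y: "y \<in> carrier X" for y
      by (rule fun_eqI) (use x y T_out T_emb A(1) coord_add in auto)
    show "T (t \<odot> x) = t \<odot>\<^bsub>c00 \<Lambda>\<^esub> T x" for t
      by (rule fun_eqI) (use x T_out T_emb A(1) coord_scale in auto)
  qed
  have T_le: "vle (c00 \<Lambda>) (T x) (T y) \<longleftrightarrow> vle X x y" if "x \<in> carrier X" "y \<in> carrier X" for x y
    using le_iff[OF that] T_emb that by (simp add: \<Lambda>_def)
  \<comment> \<open>Elements with equal images are comparable in both directions, so this is
    antisymmetry.\<close>
  have "inj_on T (carrier X)"
    by (rule inj_onI) (metis T_le le_antisym le_refl)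
  moreover have "\<exists>x\<in>carrier X. T x = g" if g: "g \<in> carrier (c00 \<Lambda>)" for g
  proof -
    have "finite (emb ` {a \<in> A. g (emb a) \<noteq> 0})"
      using g by (auto intro: finite_subset[of _ "{i. g i \<noteq> 0}"])
    then have "finite {a \<in> A. g (emb a) \<noteq> 0}"
      by (rule finite_imageD) (use inj in \<open>auto intro: inj_on_subset\<close>)
    then obtain x where x: "x \<in> carrier X"
      "\<forall>a\<in>A. coord a x = (if a \<in> {a \<in> A. g (emb a) \<noteq> 0} then g (emb a) else 0)"
      using coords_surj[of A "{a \<in> A. g (emb a) \<noteq> 0}" "\<lambda>a. g (emb a)"] A by blast
    then have "T x = g"
      by (intro fun_eqI) (use g T_out T_emb in auto)
    then show ?thesis using x by blast
  qed
  ultimately have "bij_betw T (carrier X) (carrier (c00 \<Lambda>))"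
    using T_C unfolding bij_betw_def by blast
  then have "lattice_isomorphic X (c00 \<Lambda>)"
    using T_lin T_le archimedean_c00[of \<Lambda>] vector_lattice_axioms
    by (intro lattice_isomorphicI) (auto simp: archimedean_vector_lattice_def)
  \<comment> \<open>With an empty family the coordinate criterion holds vacuously, so every element
    would equal zero, which \<open>nonzero\<close> excludes.\<close>
  moreover have "\<Lambda> \<noteq> {}"
  proof
    assume "\<Lambda> = {}"
    then have "A = {}" by (simp add: \<Lambda>_def)
    then have "x = \<zero>" if "x \<in> carrier X" for x
      using le_iff[of x "\<zero>"] le_iff[of "\<zero>" x] that by (intro le_antisym) auto
    then show False using nonzero by auto
  qed
  ultimately show ?thesis by blast
qed

section \<open>Order continuous operators\<close>

lemma (in vector_lattice) modulus_facts:
  assumes x: "x \<in> carrier X"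
  shows "modulus X x \<in> carrier X" "vle X x (modulus X x)" "vle X (\<ominus> x) (modulus X x)"
    "vle X \<zero> (modulus X x)"
proof -
  show C: "modulus X x \<in> carrier X" and le: "vle X x (modulus X x)" "vle X (\<ominus> x) (modulus X x)"
    using order.join_closed[of x "\<ominus> x"] order.join_left[of x "\<ominus> x"] order.join_right[of x "\<ominus> x"] x
    by (auto simp: modulus_def)
  show "vle X \<zero> (modulus X x)"
    by (rule le_combination[of _ _ x "modulus X x" "\<ominus> x" "modulus X x" "1/2" "1/2"])
      (use x C le in \<open>auto simp: field_simps\<close>)
qed

lemma (in vector_lattice) modulus_le_iff:
  assumes x: "x \<in> carrier X" and z: "z \<in> carrier X"
  shows "vle X (modulus X x) z \<longleftrightarrow> vle X x z \<and> vle X (\<ominus> x) z"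
proof
  assume "vle X (modulus X x) z"
  then show "vle X x z \<and> vle X (\<ominus> x) z" using modulus_facts[OF x] le_trans x z M.a_inv_closed by metis
next
  assume "vle X x z \<and> vle X (\<ominus> x) z"
  then show "vle X (modulus X x) z"
    using order.join_le[of x z "\<ominus> x"] x z by (simp add: modulus_def)
qed

lemma (in vector_lattice) minus_zero_right: "x \<in> carrier X \<Longrightarrow> x \<ominus> \<zero> = x"
  by (intro vector_eqI) auto

text \<open>This net serves as the dominating net in both directions, once in the domain and once in
  the target. That its infimum is zero is the Archimedean property; \<open>Suc n\<close> avoids
  division by zero.\<close>

lemma (in archimedean_vector_lattice) harmonic_decreases_to_zero:
  assumes u: "u \<in> carrier X" "vle X \<zero> u"
  shows "decreases_to_zero X UNIV {(m, n). m \<le> n} (\<lambda>n::nat. (1 / real (Suc n)) \<odot> u)"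
  unfolding decreases_to_zero_def
proof (intro conjI ballI impI)
  let ?y = "\<lambda>n::nat. (1 / real (Suc n)) \<odot> u"
  show "directed_by UNIV {(m, n::nat). m \<le> n}"
    by (auto simp: directed_by_def preorder_on_def refl_on_def trans_def intro: max.cobounded1 max.cobounded2)
  show "?y \<in> UNIV \<rightarrow> carrier X" using u by auto
  show "le (vorder X) (?y n) (?y m)" if "(m, n) \<in> {(m, n). m \<le> n}" for m n
    unfolding vorder_simps
    by (rule le_scaled[of _ _ "\<zero>" u "1 / real (Suc m) - 1 / real (Suc n)"])
      (use u that in \<open>auto simp: field_simps\<close>)
  show "is_glb (vorder X) \<zero> (range ?y)"
  proof (rule greatest_LowerI)
    show "le (vorder X) \<zero> v" if "v \<in> range ?y" for v
      using that u smult_nonneg by auto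
    fix w assume "w \<in> Lower (vorder X) (range ?y)"
    then have w: "w \<in> carrier X" "vle X w (?y n)" for n by (auto simp: Lower_def u)
    have "vle X w \<zero>"
    proof (rule le_zero_if_infinitesimal[OF w(1) u])
      fix e :: real assume "0 < e"
      then obtain n where "inverse (real (Suc n)) < e" using reals_Archimedean by blast
      moreover define c where "c = 1 / real (Suc n)"
      ultimately have c: "c < e" "vle X w (c \<odot> u)" using w(2)[of n] by (auto simp: inverse_eq_divide)
      show "vle X w (e \<odot> u)"
        by (rule le_combination[of _ _ w "c \<odot> u" "\<zero>" u 1 "e - c"])
          (use u w c in \<open>auto simp: algebra_simps\<close>)
    qed
    then show "le (vorder X) w \<zero>" by simp
  qed (use u in auto)
qed

lemma linear_opsD:
  assumes "T \<in> linear_ops X Y"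
  shows "x \<in> carrier X \<Longrightarrow> T x \<in> carrier Y"
    "\<lbrakk>x \<in> carrier X; y \<in> carrier X\<rbrakk> \<Longrightarrow> T (x \<oplus>\<^bsub>X\<^esub> y) = T x \<oplus>\<^bsub>Y\<^esub> T y"
    "x \<in> carrier X \<Longrightarrow> T (a \<odot>\<^bsub>X\<^esub> x) = a \<odot>\<^bsub>Y\<^esub> T x"
  using assms by (auto simp: linear_ops_def)

text \<open>The image of the net is eventually dominated by a single element \<open>w k\<close>. One
  index does this for all \<open>y\<close> in the interval simultaneously, and undoing the scaling
  at that index bounds \<open>T\<close> on the interval.\<close>

lemma order_bounded_if_order_continuous:
  fixes X :: "('a, 'm) vlat_scheme" and Y :: "('b, 'n) vlat_scheme"
  assumes X: "archimedean_vector_lattice X" and Y: "vector_lattice Y"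
    and T: "T \<in> linear_ops X Y" "order_continuous X Y T" and A: "order_bounded X A"
  shows "order_bounded Y (T ` A)"
proof -
  interpret X: archimedean_vector_lattice X by (rule X)
  interpret Y: vector_lattice Y by (rule Y)
  note lin = linear_opsD[OF T(1)]
  obtain l u where lu: "l \<in> carrier X" "u \<in> carrier X" "A \<subseteq> \<lbrace>l..u\<rbrace>\<^bsub>vorder X\<^esub>"
    using A by (auto simp: order_bounded_def)
  \<comment> \<open>An empty \<open>A\<close> may come with incomparable bounds; a nonempty one
    forces \<open>l \<le> u\<close>, so that \<open>v\<close> below is positive.\<close>
  show ?thesis
  proof (cases "A = {}")
    case True
    then show ?thesis by (auto simp: order_bounded_def)
  next
    case False
    define v where "v = u \<ominus>\<^bsub>X\<^esub> l"
    have "vle X l u" using False lu X.le_trans by (auto simp: at_least_at_most_def)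
    then have v: "v \<in> carrier X" "vle X \<zero>\<^bsub>X\<^esub> v" using lu X.le_iff_diff_nonneg by (auto simp: v_def)
    define I where "I = (UNIV :: nat set) \<times> {y \<in> carrier X. vle X \<zero>\<^bsub>X\<^esub> y \<and> vle X y v}"
    \<comment> \<open>Only first components are compared, so the tail from \<open>p\<close> contains
      \<open>(fst p, y)\<close> for every \<open>y\<close> in the interval. This is where uniformity
      in \<open>y\<close> comes from.\<close>
    define r where "r = {(p, q). p \<in> I \<and> q \<in> I \<and> fst p \<le> fst q}"
    define x where "x p = (1 / real (Suc (fst p))) \<odot>\<^bsub>X\<^esub> snd p" for p :: "nat \<times> 'a"
    have xC: "x p \<in> carrier X" if "p \<in> I" for p using that by (auto simp: x_def I_def)
    have "order_converges X I r x \<zero>\<^bsub>X\<^esub>"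
    proof (rule order_convergesI[OF X.vector_lattice_axioms _ _ _ X.harmonic_decreases_to_zero[OF v]])
      show "directed_by I r"
        unfolding directed_by_def
      proof (intro conjI ballI)
        show "I \<noteq> {}" using v by (auto simp: I_def)
        show "preorder_on I r" by (auto simp: preorder_on_def refl_on_def trans_def r_def)
        show "\<exists>k\<in>I. (p, k) \<in> r \<and> (q, k) \<in> r" if "p \<in> I" "q \<in> I" for p q
          using that by (cases "fst p \<le> fst q") (auto simp: r_def)
      qed
      show "x \<in> I \<rightarrow> carrier X" using xC by blast
      show "dominated_by X I r x \<zero>\<^bsub>X\<^esub> UNIV (\<lambda>n. (1 / real (Suc n)) \<odot>\<^bsub>X\<^esub> v)"
        unfolding dominated_by_def
      proof
        fix n :: nat
        have "vle X (modulus X (x p \<ominus>\<^bsub>X\<^esub> \<zero>\<^bsub>X\<^esub>)) ((1 / real (Suc n)) \<odot>\<^bsub>X\<^esub> v)"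
          if p: "p \<in> I" "n \<le> fst p" for p
        proof -
          obtain m y where my: "p = (m, y)" "y \<in> carrier X" "vle X \<zero>\<^bsub>X\<^esub> y" "vle X y v" "n \<le> m"
            using p by (auto simp: I_def)
          define a b where "a = 1 / real (Suc m)" and "b = 1 / real (Suc n)"
          then have ab: "0 \<le> a" "a \<le> b" "x p = a \<odot>\<^bsub>X\<^esub> y" using my by (auto simp: x_def frac_le)
          have "vle X (x p) (b \<odot>\<^bsub>X\<^esub> v)"
            by (rule X.le_combination[of _ _ y v "\<zero>\<^bsub>X\<^esub>" v a "b - a"])
              (use my v ab in \<open>auto simp: algebra_simps\<close>)
          moreover have "vle X (\<ominus>\<^bsub>X\<^esub> x p) (b \<odot>\<^bsub>X\<^esub> v)"
            by (rule X.le_combination[of _ _ "\<zero>\<^bsub>X\<^esub>" y "\<zero>\<^bsub>X\<^esub>" v a b])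
              (use my v ab in auto)
          ultimately show ?thesis
            using X.modulus_le_iff xC[OF p(1)] v unfolding b_def by (simp add: X.minus_zero_right)
        qed
        moreover have "(n, v) \<in> I" using v by (auto simp: I_def)
        ultimately show "\<exists>\<alpha>\<^sub>0\<in>I. \<forall>\<alpha>\<in>I. (\<alpha>\<^sub>0, \<alpha>) \<in> r \<longrightarrow>
            modulus X (x \<alpha> \<ominus>\<^bsub>X\<^esub> \<zero>\<^bsub>X\<^esub>) \<sqsubseteq>\<^bsub>vorder X\<^esub> (1 / real (Suc n)) \<odot>\<^bsub>X\<^esub> v"
          by (intro bexI[of _ "(n, v)"]) (auto simp: r_def)
      qed
    qed simp
    then have "order_converges Y I r (\<lambda>p. T (x p)) \<zero>\<^bsub>Y\<^esub>"
      using lin(1) by (intro order_continuousD[OF X.vector_lattice_axioms T(2)]) auto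
    then obtain K :: "'b set" and t w where w: "decreases_to_zero Y K t w"
      and d: "dominated_by Y I r (\<lambda>p. T (x p)) \<zero>\<^bsub>Y\<^esub> K w"
      by (auto simp: order_converges_def)
    then obtain k where k: "k \<in> K" "w k \<in> carrier Y"
      by (auto simp: decreases_to_zero_def directed_by_def)
    then obtain p where p: "p \<in> I" "\<forall>q\<in>I. (p, q) \<in> r \<longrightarrow> vle Y (modulus Y (T (x q) \<ominus>\<^bsub>Y\<^esub> \<zero>\<^bsub>Y\<^esub>)) (w k)"
      using d by (auto simp: dominated_by_def)
    \<comment> \<open>The inverse of the factor that \<open>x\<close> carries at the index
      \<open>p\<close>.\<close>
    define c where "c = real (Suc (fst p))"
    have c: "0 < c" by (simp add: c_def)
    have bound: "vle Y (T y) (c \<odot>\<^bsub>Y\<^esub> w k)" "vle Y (\<ominus>\<^bsub>Y\<^esub> T y) (c \<odot>\<^bsub>Y\<^esub> w k)"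
      if y: "y \<in> carrier X" "vle X \<zero>\<^bsub>X\<^esub> y" "vle X y v" for y
    proof -
      have q: "(fst p, y) \<in> I" "(p, (fst p, y)) \<in> r" using y p by (auto simp: I_def r_def)
      have TC: "T y \<in> carrier Y" using lin(1) y by simp
      have "T (x (fst p, y)) = (1 / c) \<odot>\<^bsub>Y\<^esub> T y" using lin(3) y by (simp add: x_def c_def)
      then have "vle Y (modulus Y ((1 / c) \<odot>\<^bsub>Y\<^esub> T y)) (w k)"
        using p(2) q TC by (force simp: Y.minus_zero_right)
      then have le: "vle Y ((1 / c) \<odot>\<^bsub>Y\<^esub> T y) (w k)" "vle Y (\<ominus>\<^bsub>Y\<^esub> ((1 / c) \<odot>\<^bsub>Y\<^esub> T y)) (w k)"
        using Y.modulus_le_iff TC k by auto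
      show "vle Y (T y) (c \<odot>\<^bsub>Y\<^esub> w k)"
        by (rule Y.le_scaled[OF _ _ _ _ le(1), of _ _ c]) (use TC k c in \<open>auto simp: algebra_simps\<close>)
      show "vle Y (\<ominus>\<^bsub>Y\<^esub> T y) (c \<odot>\<^bsub>Y\<^esub> w k)"
        by (rule Y.le_scaled[OF _ _ _ _ le(2), of _ _ c]) (use TC k c in \<open>auto simp: algebra_simps\<close>)
    qed
    have "T ` A \<subseteq> \<lbrace>T l \<ominus>\<^bsub>Y\<^esub> c \<odot>\<^bsub>Y\<^esub> w k..T l \<oplus>\<^bsub>Y\<^esub> c \<odot>\<^bsub>Y\<^esub> w k\<rbrace>\<^bsub>vorder Y\<^esub>"
    proof (rule image_subsetI)
      fix z assume "z \<in> A"
      then have z: "z \<in> carrier X" "vle X l z" "vle X z u" using lu by (auto simp: at_least_at_most_def)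
      define y where "y = z \<ominus>\<^bsub>X\<^esub> l"
      have y: "y \<in> carrier X" "vle X \<zero>\<^bsub>X\<^esub> y" using z lu X.le_iff_diff_nonneg by (auto simp: y_def)
      have "vle X y v" unfolding y_def v_def
        by (rule X.le_scaled[of _ _ z u 1]) (use z lu in auto)
      note b = bound[OF y this]
      have "z = y \<oplus>\<^bsub>X\<^esub> l" unfolding y_def using z lu by (intro X.vector_eqI) auto
      then have Tz: "T z = T y \<oplus>\<^bsub>Y\<^esub> T l" using lin(2) y lu by simp
      have C: "T y \<in> carrier Y" "T l \<in> carrier Y" "w k \<in> carrier Y" using lin(1) y lu k by auto
      have "vle Y (T l \<ominus>\<^bsub>Y\<^esub> c \<odot>\<^bsub>Y\<^esub> w k) (T z)"
        unfolding Tz by (rule Y.le_scaled[OF _ _ _ _ b(2), of _ _ 1]) (use C in auto)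
      moreover have "vle Y (T z) (T l \<oplus>\<^bsub>Y\<^esub> c \<odot>\<^bsub>Y\<^esub> w k)"
        unfolding Tz by (rule Y.le_scaled[OF _ _ _ _ b(1), of _ _ 1]) (use C in auto)
      ultimately show "T z \<in> \<lbrace>T l \<ominus>\<^bsub>Y\<^esub> c \<odot>\<^bsub>Y\<^esub> w k..T l \<oplus>\<^bsub>Y\<^esub> c \<odot>\<^bsub>Y\<^esub> w k\<rbrace>\<^bsub>vorder Y\<^esub>"
        using z lin(1) by (simp add: at_least_at_most_def)
    qed
    then show ?thesis
      using lin(1) lu k unfolding order_bounded_def
      by (intro bexI[of _ "T l \<ominus>\<^bsub>Y\<^esub> c \<odot>\<^bsub>Y\<^esub> w k"] bexI[of _ "T l \<oplus>\<^bsub>Y\<^esub> c \<odot>\<^bsub>Y\<^esub> w k"]) auto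
  qed
qed

text \<open>The witness \<open>W\<close> is the sum of the moduli of \<open>T e\<close> over the
  unit vectors \<open>e\<close> supported in \<open>F\<close>. It acts as a gauge for
  \<open>T\<close> on the vectors supported in \<open>F\<close>. The conditions on \<open>x\<close>
  are symmetric under a change of sign, so the one-sided bound also controls the modulus.\<close>

lemma c00_domination:
  assumes X: "vector_lattice X" and Y: "vector_lattice Y"
    and \<Phi>: "\<Phi> \<in> linear_ops X (c00 \<Lambda>)" "bij_betw \<Phi> (carrier X) (carrier (c00 \<Lambda>))"
    and T: "T \<in> linear_ops X Y" and F: "finite F" "F \<subseteq> \<Lambda>"
  shows "\<exists>W\<in>carrier Y. vle Y \<zero>\<^bsub>Y\<^esub> W \<and> (\<forall>x\<in>carrier X. \<forall>c\<ge>0.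
    (\<forall>i. i \<notin> F \<longrightarrow> \<Phi> x i = 0) \<longrightarrow> (\<forall>i\<in>F. \<bar>\<Phi> x i\<bar> \<le> c) \<longrightarrow> vle Y (T x) (c \<odot>\<^bsub>Y\<^esub> W))"
  using F
proof (induction F)
  interpret X: vector_lattice X by (rule X)
  interpret Y: vector_lattice Y by (rule Y)
  note lin = linear_opsD[OF T] and \<Phi>_lin = linear_opsD[OF \<Phi>(1)]
  {
    case empty
    have "T x = \<zero>\<^bsub>Y\<^esub>" if x: "x \<in> carrier X" "\<forall>i. \<Phi> x i = 0" for x
    proof -
      have "\<Phi> \<zero>\<^bsub>X\<^esub> = (\<lambda>i. 0)" using \<Phi>_lin(3)[of "\<zero>\<^bsub>X\<^esub>" 0] by simp
      then have "\<Phi> x = \<Phi> \<zero>\<^bsub>X\<^esub>" using x by auto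
      then have "x = \<zero>\<^bsub>X\<^esub>" using \<Phi>(2) x by (auto simp: bij_betw_def inj_on_def)
      then show ?thesis using lin(3)[of "\<zero>\<^bsub>X\<^esub>" 0] lin(1) by simp
    qed
    then show ?case by (intro bexI[of _ "\<zero>\<^bsub>Y\<^esub>"]) auto
  next
    case (insert i F)
    then obtain W where W: "W \<in> carrier Y" "vle Y \<zero>\<^bsub>Y\<^esub> W"
      and dom: "\<And>x c. \<lbrakk>x \<in> carrier X; 0 \<le> c; \<forall>i. i \<notin> F \<longrightarrow> \<Phi> x i = 0; \<forall>i\<in>F. \<bar>\<Phi> x i\<bar> \<le> c\<rbrakk>
        \<Longrightarrow> vle Y (T x) (c \<odot>\<^bsub>Y\<^esub> W)" by auto
    have "(\<lambda>j. if j = i then 1 else 0) \<in> carrier (c00 \<Lambda>)" using insert.prems by auto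
    then obtain e where e: "e \<in> carrier X" "\<Phi> e = (\<lambda>j. if j = i then 1 else 0)"
      using \<Phi>(2) unfolding bij_betw_def by (metis imageE)
    define V where "V = modulus Y (T e)"
    have Te: "T e \<in> carrier Y" using lin(1) e by simp
    have V: "V \<in> carrier Y" "vle Y \<zero>\<^bsub>Y\<^esub> V" "vle Y (T e) V" "vle Y (\<ominus>\<^bsub>Y\<^esub> T e) V"
      using Y.modulus_facts[OF Te] by (auto simp: V_def)
    have "vle Y (T x) (c \<odot>\<^bsub>Y\<^esub> (W \<oplus>\<^bsub>Y\<^esub> V))"
      if x: "x \<in> carrier X" "0 \<le> c" "\<forall>j. j \<notin> insert i F \<longrightarrow> \<Phi> x j = 0"
        "\<forall>j\<in>insert i F. \<bar>\<Phi> x j\<bar> \<le> c" for x c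
    proof -
      define s where "s = \<Phi> x i"
      \<comment> \<open>Deletes the coordinate at \<open>i\<close>, so that the induction hypothesis
        applies.\<close>
      define x' where "x' = x \<oplus>\<^bsub>X\<^esub> (- s) \<odot>\<^bsub>X\<^esub> e"
      have x': "x' \<in> carrier X" using x e by (simp add: x'_def)
      have "\<Phi> x' j = (if j = i then 0 else \<Phi> x j)" for j
        using \<Phi>_lin(2)[of x "(- s) \<odot>\<^bsub>X\<^esub> e"] \<Phi>_lin(3)[of e "- s"] x e by (simp add: x'_def s_def)
      then have le: "vle Y (T x') (c \<odot>\<^bsub>Y\<^esub> W)" using dom[OF x' x(2)] x insert.hyps by auto
      have "x = x' \<oplus>\<^bsub>X\<^esub> s \<odot>\<^bsub>X\<^esub> e" unfolding x'_def using x e by (intro X.vector_eqI) auto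
      then have Tx: "T x = T x' \<oplus>\<^bsub>Y\<^esub> s \<odot>\<^bsub>Y\<^esub> T e" using lin e x' by simp
      have Tx': "T x' \<in> carrier Y" using lin x' by simp
      have s: "s \<le> c" "- s \<le> c" using x(4) by (auto simp: s_def abs_le_iff)
      \<comment> \<open>The sign of \<open>s\<close> decides which of the two bounds by
        \<open>V\<close> is scaled by its absolute value; the remaining multiple of \<open>V\<close>
        has the nonnegative coefficient \<open>c - \<bar>s\<bar>\<close>.\<close>
      have "vle Y (s \<odot>\<^bsub>Y\<^esub> T e) (c \<odot>\<^bsub>Y\<^esub> V)"
      proof (cases "0 \<le> s")
        case True
        show ?thesis
          by (rule Y.le_combination[of _ _ "T e" V "\<zero>\<^bsub>Y\<^esub>" V s "c - s"])
            (use True s V Te in \<open>auto simp: algebra_simps\<close>)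
      next
        case False
        show ?thesis
          by (rule Y.le_combination[of _ _ "\<ominus>\<^bsub>Y\<^esub> T e" V "\<zero>\<^bsub>Y\<^esub>" V "- s" "c + s"])
            (use False s V Te in \<open>auto simp: algebra_simps\<close>)
      qed
      with le show ?thesis unfolding Tx
        by (intro Y.le_combination[of "T x' \<oplus>\<^bsub>Y\<^esub> s \<odot>\<^bsub>Y\<^esub> T e" "c \<odot>\<^bsub>Y\<^esub> (W \<oplus>\<^bsub>Y\<^esub> V)" "T x'" "c \<odot>\<^bsub>Y\<^esub> W"
              "s \<odot>\<^bsub>Y\<^esub> T e" "c \<odot>\<^bsub>Y\<^esub> V" 1 1])
          (use Tx' Te V W in \<open>auto simp: algebra_simps\<close>)
    qed
    moreover have "vle Y \<zero>\<^bsub>Y\<^esub> (W \<oplus>\<^bsub>Y\<^esub> V)"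
      by (rule Y.le_combination[of _ _ "\<zero>\<^bsub>Y\<^esub>" W "\<zero>\<^bsub>Y\<^esub>" V 1 1]) (use V W in auto)
    ultimately show ?case using V W by (intro bexI[of _ "W \<oplus>\<^bsub>Y\<^esub> V"]) auto
  }
qed

lemma order_continuous_if_isomorphic_c00:
  fixes X :: "('a, 'm) vlat_scheme" and Y :: "('b, 'n) vlat_scheme"
  assumes X: "vector_lattice X" and Y: "archimedean_vector_lattice Y"
    and iso: "lattice_isomorphic X (c00 \<Lambda>)" and T: "T \<in> linear_ops X Y"
  shows "order_continuous X Y T"
  unfolding order_continuous_def
proof (intro allI impI)
  fix I :: "('a \<times> 'a) set" and r x
  assume conv: "order_converges X I r x \<zero>\<^bsub>X\<^esub>"
  interpret X: vector_lattice X by (rule X)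
  interpret Y: archimedean_vector_lattice Y by (rule Y)
  note lin = linear_opsD[OF T]
  have "vector_lattice (c00 \<Lambda>)" using archimedean_c00 archimedean_vector_lattice.axioms(1) by blast
  then obtain \<Phi> where \<Phi>: "\<Phi> \<in> linear_ops X (c00 \<Lambda>)" "bij_betw \<Phi> (carrier X) (carrier (c00 \<Lambda>))"
    and \<Phi>_le: "\<forall>x\<in>carrier X. \<forall>y\<in>carrier X. vle (c00 \<Lambda>) (\<Phi> x) (\<Phi> y) \<longleftrightarrow> vle X x y"
    using lattice_isomorphicE[OF X _ iso] by blast
  note \<Phi>_lin = linear_opsD[OF \<Phi>(1)]
  have \<Phi>_out: "\<Phi> z i = 0" if "z \<in> carrier X" "i \<notin> \<Lambda>" for z i using \<Phi>_lin(1)[OF that(1)] that by simp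
  have \<Phi>_mono: "\<Phi> z i \<le> \<Phi> z' i" if "z \<in> carrier X" "z' \<in> carrier X" "vle X z z'" for z z' i
    using \<Phi>_le that \<Phi>_out by (cases "i \<in> \<Lambda>") auto
  have \<Phi>_zero: "\<Phi> \<zero>\<^bsub>X\<^esub> = (\<lambda>i. 0)" using \<Phi>_lin(3)[of "\<zero>\<^bsub>X\<^esub>" 0] by simp
  have \<Phi>_minus: "\<Phi> (\<ominus>\<^bsub>X\<^esub> z) i = - \<Phi> z i" if "z \<in> carrier X" for z i
    using \<Phi>_lin(3)[of z "-1"] that by (simp add: X.minus_eq_scale)
  obtain J :: "'a set" and s y where y: "decreases_to_zero X J s y" and d: "dominated_by X I r x \<zero>\<^bsub>X\<^esub> J y"
    and I: "directed_by I r" and xI: "x \<in> I \<rightarrow> carrier X"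
    using conv by (auto simp: order_converges_def)
  have J: "directed_by J s" and yC: "\<And>\<beta>. \<beta> \<in> J \<Longrightarrow> y \<beta> \<in> carrier X"
    and dec: "\<And>\<beta> \<gamma>. \<beta> \<in> J \<Longrightarrow> \<gamma> \<in> J \<Longrightarrow> (\<beta>, \<gamma>) \<in> s \<Longrightarrow> vle X (y \<gamma>) (y \<beta>)"
    and glb: "is_glb (vorder X) \<zero>\<^bsub>X\<^esub> (y ` J)"
    using y by (auto simp: decreases_to_zero_def)
  have y_nonneg: "vle X \<zero>\<^bsub>X\<^esub> (y \<beta>)" if "\<beta> \<in> J" for \<beta>
    using glb yC that by (auto simp: greatest_def Lower_def)
  \<comment> \<open>Otherwise \<epsilon> times the unit vector at \<open>i\<close> would be a lower
    bound of the dominating net, contradicting its infimum zero.\<close>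
  have small: "\<exists>\<beta>\<in>J. \<Phi> (y \<beta>) i \<le> \<epsilon>" if i: "i \<in> \<Lambda>" and \<epsilon>: "0 < \<epsilon>" for i \<epsilon>
  proof (rule ccontr)
    assume "\<not> (\<exists>\<beta>\<in>J. \<Phi> (y \<beta>) i \<le> \<epsilon>)"
    then have big: "\<epsilon> < \<Phi> (y \<beta>) i" if "\<beta> \<in> J" for \<beta> using that by force
    have "(\<lambda>j. if j = i then \<epsilon> else 0) \<in> carrier (c00 \<Lambda>)" using i by auto
    then obtain e where e: "e \<in> carrier X" "\<Phi> e = (\<lambda>j. if j = i then \<epsilon> else 0)"
      using \<Phi>(2) unfolding bij_betw_def by (metis imageE)
    have "vle X e (y \<beta>)" if "\<beta> \<in> J" for \<beta>
    proof -
      have "\<Phi> e j \<le> \<Phi> (y \<beta>) j" for j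
        using big[OF that] \<Phi>_mono[OF _ yC[OF that] y_nonneg[OF that], of j] by (simp add: e \<Phi>_zero)
      then show ?thesis using \<Phi>_le e(1) yC[OF that] by auto
    qed
    then have "e \<in> Lower (vorder X) (y ` J)" using e by (auto simp: Lower_def)
    then have "vle X e \<zero>\<^bsub>X\<^esub>" using glb by (auto simp: greatest_def)
    then have "\<Phi> e i \<le> 0" using \<Phi>_mono[of e "\<zero>\<^bsub>X\<^esub>" i] e(1) \<Phi>_zero by simp
    then show False using e \<epsilon> by simp
  qed
  obtain \<beta>\<^sub>0 where \<beta>\<^sub>0: "\<beta>\<^sub>0 \<in> J" using J by (auto simp: directed_by_def)
  \<comment> \<open>Any single member of the dominating net fixes the finite support: later members
    lie between zero and it, hence vanish outside \<open>F\<close>.\<close>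
  define F where "F = {i. \<Phi> (y \<beta>\<^sub>0) i \<noteq> 0}"
  have F: "finite F" "F \<subseteq> \<Lambda>" using \<Phi>_lin(1)[OF yC[OF \<beta>\<^sub>0]] by (auto simp: F_def)
  \<comment> \<open>Directedness merges the indices found for finitely many coordinates, and
    monotonicity preserves the bounds already reached.\<close>
  have uniform: "\<exists>\<beta>\<in>J. (\<beta>\<^sub>0, \<beta>) \<in> s \<and> (\<forall>i\<in>G. \<Phi> (y \<beta>) i \<le> \<epsilon>)"
    if "finite G" "G \<subseteq> F" and \<epsilon>: "0 < \<epsilon>" for G \<epsilon>
    using that(1,2)
  proof (induction G)
    case empty
    then show ?case using J \<beta>\<^sub>0 by (auto simp: directed_by_def preorder_on_def refl_on_def)
  next
    case (insert i G)
    then obtain \<beta> where \<beta>: "\<beta> \<in> J" "(\<beta>\<^sub>0, \<beta>) \<in> s" "\<forall>i\<in>G. \<Phi> (y \<beta>) i \<le> \<epsilon>" by auto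
    have "i \<in> \<Lambda>" using insert.prems F by auto
    then obtain \<gamma> where \<gamma>: "\<gamma> \<in> J" "\<Phi> (y \<gamma>) i \<le> \<epsilon>" using small \<epsilon> by blast
    obtain \<delta> where \<delta>: "\<delta> \<in> J" "(\<beta>, \<delta>) \<in> s" "(\<gamma>, \<delta>) \<in> s"
      using J \<beta>(1) \<gamma>(1) unfolding directed_by_def by blast
    have "(\<beta>\<^sub>0, \<delta>) \<in> s" using J \<beta>(2) \<delta>(2) unfolding directed_by_def preorder_on_def by (meson transD)
    moreover have "\<Phi> (y \<delta>) j \<le> \<epsilon>" if "j \<in> insert i G" for j
    proof (cases "j = i")
      case True
      then show ?thesis using \<Phi>_mono[OF yC[OF \<delta>(1)] yC[OF \<gamma>(1)] dec[OF \<gamma>(1) \<delta>(1,3)], of i] \<gamma> by simp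
    next
      case False
      then have "\<Phi> (y \<beta>) j \<le> \<epsilon>" using \<beta>(3) that by blast
      then show ?thesis using \<Phi>_mono[OF yC[OF \<delta>(1)] yC[OF \<beta>(1)] dec[OF \<beta>(1) \<delta>(1,2)], of j] by simp
    qed
    ultimately show ?case using \<delta>(1) by blast
  qed
  obtain W where W: "W \<in> carrier Y" "vle Y \<zero>\<^bsub>Y\<^esub> W"
    and dom: "\<forall>x\<in>carrier X. \<forall>c\<ge>0. (\<forall>i. i \<notin> F \<longrightarrow> \<Phi> x i = 0) \<longrightarrow> (\<forall>i\<in>F. \<bar>\<Phi> x i\<bar> \<le> c) \<longrightarrow>
      vle Y (T x) (c \<odot>\<^bsub>Y\<^esub> W)"
    using c00_domination[OF X Y.vector_lattice_axioms \<Phi> T F] by blast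
  show "order_converges Y I r (\<lambda>\<alpha>. T (x \<alpha>)) \<zero>\<^bsub>Y\<^esub>"
  proof (rule order_convergesI[OF Y.vector_lattice_axioms I _ _ Y.harmonic_decreases_to_zero[OF W]])
    show "(\<lambda>\<alpha>. T (x \<alpha>)) \<in> I \<rightarrow> carrier Y" using xI lin(1) by auto
    show "dominated_by Y I r (\<lambda>\<alpha>. T (x \<alpha>)) \<zero>\<^bsub>Y\<^esub> UNIV (\<lambda>n. (1 / real (Suc n)) \<odot>\<^bsub>Y\<^esub> W)"
      unfolding dominated_by_def
    proof
      fix n :: nat
      define \<epsilon> where "\<epsilon> = 1 / real (Suc n)"
      have \<epsilon>: "0 < \<epsilon>" by (simp add: \<epsilon>_def)
      \<comment> \<open>This index controls support and size together: it lies beyond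
        \<open>\<beta>\<^sub>0\<close>, and all coordinates in \<open>F\<close> are at most
        \<epsilon>.\<close>
      obtain \<beta> where \<beta>: "\<beta> \<in> J" "(\<beta>\<^sub>0, \<beta>) \<in> s" "\<forall>i\<in>F. \<Phi> (y \<beta>) i \<le> \<epsilon>"
        using uniform[OF F(1) order_refl \<epsilon>] by blast
      obtain \<alpha>\<^sub>0 where \<alpha>\<^sub>0: "\<alpha>\<^sub>0 \<in> I"
        "\<And>\<alpha>. \<lbrakk>\<alpha> \<in> I; (\<alpha>\<^sub>0, \<alpha>) \<in> r\<rbrakk> \<Longrightarrow> vle X (modulus X (x \<alpha> \<ominus>\<^bsub>X\<^esub> \<zero>\<^bsub>X\<^esub>)) (y \<beta>)"
        using d \<beta>(1) by (auto simp: dominated_by_def)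
      have "vle Y (modulus Y (T (x \<alpha>) \<ominus>\<^bsub>Y\<^esub> \<zero>\<^bsub>Y\<^esub>)) (\<epsilon> \<odot>\<^bsub>Y\<^esub> W)"
        if \<alpha>: "\<alpha> \<in> I" "(\<alpha>\<^sub>0, \<alpha>) \<in> r" for \<alpha>
      proof -
        have xC: "x \<alpha> \<in> carrier X" using xI \<alpha> by blast
        have "vle X (modulus X (x \<alpha>)) (y \<beta>)" using \<alpha>\<^sub>0(2)[OF \<alpha>] xC by (simp add: X.minus_zero_right)
        then have le: "vle X (x \<alpha>) (y \<beta>)" "vle X (\<ominus>\<^bsub>X\<^esub> x \<alpha>) (y \<beta>)"
          using X.modulus_le_iff xC yC[OF \<beta>(1)] by auto
        have abs: "\<bar>\<Phi> (x \<alpha>) i\<bar> \<le> \<Phi> (y \<beta>) i" for i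
          using \<Phi>_mono[OF _ yC[OF \<beta>(1)] le(1), of i] \<Phi>_mono[OF _ yC[OF \<beta>(1)] le(2), of i] xC
          by (simp add: \<Phi>_minus abs_le_iff)
        have out: "\<Phi> (x \<alpha>) i = 0" if "i \<notin> F" for i
          using abs[of i] \<Phi>_mono[OF yC[OF \<beta>(1)] yC[OF \<beta>\<^sub>0] dec[OF \<beta>\<^sub>0 \<beta>(1,2)], of i] that
          by (simp add: F_def)
        have bd: "\<bar>\<Phi> (x \<alpha>) i\<bar> \<le> \<epsilon>" if "i \<in> F" for i using abs[of i] \<beta>(3) that by force
        have "vle Y (T (x \<alpha>)) (\<epsilon> \<odot>\<^bsub>Y\<^esub> W)" using dom xC \<epsilon> out bd by auto
        moreover have "vle Y (T (\<ominus>\<^bsub>X\<^esub> x \<alpha>)) (\<epsilon> \<odot>\<^bsub>Y\<^esub> W)"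
          using dom xC \<epsilon> out bd by (auto simp: \<Phi>_minus)
        moreover have "T (\<ominus>\<^bsub>X\<^esub> x \<alpha>) = \<ominus>\<^bsub>Y\<^esub> T (x \<alpha>)"
          using lin(1,3) xC by (simp add: X.minus_eq_scale Y.minus_eq_scale)
        ultimately show ?thesis
          using Y.modulus_le_iff[of "T (x \<alpha>)"] lin(1) xC W by (simp add: Y.minus_zero_right)
      qed
      then show "\<exists>\<alpha>\<^sub>0\<in>I. \<forall>\<alpha>\<in>I. (\<alpha>\<^sub>0, \<alpha>) \<in> r \<longrightarrow>
          modulus Y (T (x \<alpha>) \<ominus>\<^bsub>Y\<^esub> \<zero>\<^bsub>Y\<^esub>) \<sqsubseteq>\<^bsub>vorder Y\<^esub> (1 / real (Suc n)) \<odot>\<^bsub>Y\<^esub> W"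
        using \<alpha>\<^sub>0(1) unfolding \<epsilon>_def vorder_simps by blast
    qed
  qed simp
qed

section \<open>The reals inside the universe\<close>

text \<open>The ordered field of scalars transported along \<open>g\<close>. The statements about
  all \<open>Y\<close> range over lattices on the universe type, so \<open>real_vlat\<close> has to
  be replaced by such a copy before they apply.\<close>

definition real_copy :: "(real \<Rightarrow> 'u) \<Rightarrow> 'u vlat" where
  "real_copy g = \<lparr>carrier = range g, mult = (\<lambda>u v. g (the_inv g u * the_inv g v)), one = g 1, zero = g 0,
     add = (\<lambda>u v. g (the_inv g u + the_inv g v)), smult = (\<lambda>a u. g (a * the_inv g u)),
     vle = (\<lambda>u v. the_inv g u \<le> the_inv g v)\<rparr>"

lemma archimedean_real_copy:
  assumes g: "inj g" shows "archimedean_vector_lattice (real_copy g)"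
proof -
  let ?Y = "real_copy g"
  have [simp]: "the_inv g (g t) = t" for t using g by (rule the_inv_f_f)
  have [simp]: "carrier ?Y = range g" "\<zero>\<^bsub>?Y\<^esub> = g 0" "u \<oplus>\<^bsub>?Y\<^esub> v = g (the_inv g u + the_inv g v)"
    "a \<odot>\<^bsub>?Y\<^esub> u = g (a * the_inv g u)" "vle ?Y u v \<longleftrightarrow> the_inv g u \<le> the_inv g v" for u v a
    by (auto simp: real_copy_def)
  have ag: "abelian_group ?Y"
  proof (rule abelian_groupI)
    show "\<exists>y\<in>carrier ?Y. y \<oplus>\<^bsub>?Y\<^esub> x = \<zero>\<^bsub>?Y\<^esub>" if "x \<in> carrier ?Y" for x
      using that by (intro bexI[of _ "g (- the_inv g x)"]) auto
  qed (auto simp: algebra_simps)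
  have mod: "module real_ring ?Y"
    by (rule moduleI[OF cring_real_ring ag]) (auto simp: real_ring_def algebra_simps)
  have po: "partial_order (vorder ?Y)"
    by unfold_locales auto
  have lat: "Lattice.lattice (vorder ?Y)"
  proof -
    interpret partial_order "vorder ?Y" by (rule po)
    show ?thesis
    proof unfold_locales
      fix u v assume "u \<in> carrier (vorder ?Y)" "v \<in> carrier (vorder ?Y)"
      then obtain s t where [simp]: "u = g s" "v = g t" by auto
      show "\<exists>w. least (vorder ?Y) w (Upper (vorder ?Y) {u, v})"
        by (intro exI[of _ "g (max s t)"]) (auto simp: least_def Upper_def)
      show "\<exists>w. greatest (vorder ?Y) w (Lower (vorder ?Y) {u, v})"
        by (intro exI[of _ "g (min s t)"]) (auto simp: greatest_def Lower_def)
    qed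
  qed
  have arch: "s = 0" if "0 \<le> s" "\<And>n::nat. real n * s \<le> t" for s t :: real
    using that reals_Archimedean3[of s] by (metis less_eq_real_def not_less)
  show ?thesis
    by (intro archimedean_vector_lattice.intro vector_lattice.intro mod lat
        vector_lattice_axioms.intro archimedean_vector_lattice_axioms.intro)
      (auto intro!: arg_cong[of _ _ g] arch)
qed

text \<open>A functional \<open>f\<close> becomes an operator by composition with \<open>g\<close>,
  and the order bounds of its image are read back through \<open>the_inv g\<close>.\<close>

lemma order_dual_eq_if_bounded_into_real_copy:
  fixes g :: "real \<Rightarrow> 'u"
  assumes X: "vector_lattice X" and g: "inj g"
    and eq: "linear_ops X (real_copy g) = order_bounded_ops X (real_copy g)"
  shows "order_dual X = algebraic_dual X"
proof
  interpret vector_lattice X by (rule X)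
  show "order_dual X \<subseteq> algebraic_dual X" by (auto simp: order_bounded_ops_def)
  show "algebraic_dual X \<subseteq> order_dual X"
  proof
    fix f assume f: "f \<in> algebraic_dual X"
    have inv_g [simp]: "the_inv g (g t) = t" for t using g by (rule the_inv_f_f)
    define T where "T = restrict (\<lambda>x. g (f x)) (carrier X)"
    have "T \<in> linear_ops X (real_copy g)"
      unfolding linear_ops_def
    proof (intro CollectI conjI ballI allI)
      show "T \<in> carrier X \<rightarrow>\<^sub>E carrier (real_copy g)" by (auto simp: T_def real_copy_def)
      fix x assume x: "x \<in> carrier X"
      show "T (x \<oplus>\<^bsub>X\<^esub> y) = T x \<oplus>\<^bsub>real_copy g\<^esub> T y" if "y \<in> carrier X" for y
        unfolding T_def using x that functional_add[OF f x that] by (simp add: real_copy_def)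
      show "T (a \<odot>\<^bsub>X\<^esub> x) = a \<odot>\<^bsub>real_copy g\<^esub> T x" for a
        unfolding T_def using x functional_scale[OF f x] by (simp add: real_copy_def)
    qed
    then have T: "T \<in> order_bounded_ops X (real_copy g)" unfolding eq .
    have "order_bounded real_vlat (f ` A)" if A: "order_bounded X A" for A
    proof -
      have AC: "A \<subseteq> carrier X" using A by (auto simp: order_bounded_def at_least_at_most_def)
      have "order_bounded (real_copy g) (T ` A)" using T A by (simp add: order_bounded_ops_def)
      then obtain l u where lu: "T ` A \<subseteq> \<lbrace>l..u\<rbrace>\<^bsub>vorder (real_copy g)\<^esub>"
        unfolding order_bounded_def by blast
      have "the_inv g l \<le> f x \<and> f x \<le> the_inv g u" if "x \<in> A" for x
      proof -
        have "T x \<in> \<lbrace>l..u\<rbrace>\<^bsub>vorder (real_copy g)\<^esub>" "T x = g (f x)"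
          using lu that AC by (auto simp: T_def)
        then show ?thesis by (simp add: at_least_at_most_def real_copy_def)
      qed
      then show ?thesis unfolding order_bounded_def
        by (intro bexI[of _ "the_inv g l"] bexI[of _ "the_inv g u"])
          (auto simp: at_least_at_most_def real_vlat_def)
    qed
    then show "f \<in> order_dual X" using f by (simp add: order_bounded_ops_def)
  qed
qed

text \<open>Provides the injection of the reals into the universe type on which
  \<open>real_copy\<close> rests; it exists because the lattice has a nonzero vector.\<close>

lemma (in vector_lattice) inj_real_multiples:
  assumes emb: "inj_on emb (carrier X)" and x: "x \<in> carrier X" "x \<noteq> \<zero>"
  shows "inj (\<lambda>t. emb (t \<odot> x))"
proof (rule injI)
  fix s t assume "emb (s \<odot> x) = emb (t \<odot> x)"
  then have st: "s \<odot> x = t \<odot> x" using emb x by (simp add: inj_on_eq_iff)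
  have "(s - t) \<odot> x = s \<odot> x \<ominus> t \<odot> x"
    using x by (intro vector_eqI) (auto simp: algebra_simps)
  also have "\<dots> = \<zero>" unfolding st using x by (intro vector_eqI) auto
  finally show "s = t" using scale_eq_zero_imp[of x "s - t"] x by auto
qed

text \<open>The implications are proved as one cycle in the order i, ii, iii, iv. The step into iv
  is the one that selects a particular \<open>Y\<close>, the copy of the reals carried by the
  multiples of a nonzero vector.\<close>

theorem theorem6p1:
  fixes X :: "'a vlat" and emb :: "'a \<Rightarrow> 'u"
  assumes X: "archimedean_vector_lattice X"
    and nonzero: "carrier X \<noteq> {\<zero>\<^bsub>X\<^esub>}"
    and universe: "inj_on emb (carrier X)"
  shows
    "let
       i = (\<exists>\<Lambda>::'u set. \<Lambda> \<noteq> {} \<and> lattice_isomorphic X (c00 \<Lambda>));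
       ii = (\<forall>Y::'u vlat. archimedean_vector_lattice Y \<longrightarrow> linear_ops X Y = order_continuous_ops X Y);
       iii = (\<forall>Y::'u vlat. archimedean_vector_lattice Y \<longrightarrow> linear_ops X Y = order_bounded_ops X Y);
       iv = (order_dual X = algebraic_dual X)
     in (i \<longleftrightarrow> ii) \<and> (ii \<longleftrightarrow> iii) \<and> (iii \<longleftrightarrow> iv)"
proof -
  interpret archimedean_vector_lattice X by (rule X)
  let ?i = "\<exists>\<Lambda>::'u set. \<Lambda> \<noteq> {} \<and> lattice_isomorphic X (c00 \<Lambda>)"
  let ?ii = "\<forall>Y::'u vlat. archimedean_vector_lattice Y \<longrightarrow> linear_ops X Y = order_continuous_ops X Y"
  let ?iii = "\<forall>Y::'u vlat. archimedean_vector_lattice Y \<longrightarrow> linear_ops X Y = order_bounded_ops X Y"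
  let ?iv = "order_dual X = algebraic_dual X"
  have "?ii" if ?i
    using that order_continuous_if_isomorphic_c00[OF vector_lattice_axioms]
    by (auto simp: order_continuous_ops_def)
  moreover have "?iii" if ?ii
  proof (intro allI impI)
    fix Y :: "'u vlat" assume Y: "archimedean_vector_lattice Y"
    then have "linear_ops X Y = order_continuous_ops X Y" using that by blast
    then have "order_continuous X Y T" if "T \<in> linear_ops X Y" for T
      using that by (auto simp: order_continuous_ops_def)
    then show "linear_ops X Y = order_bounded_ops X Y"
      using order_bounded_if_order_continuous[OF X archimedean_vector_lattice.axioms(1)[OF Y]]
      by (auto simp: order_bounded_ops_def)
  qed
  moreover have "?iv" if ?iii
  proof -
    obtain x where "x \<in> carrier X" "x \<noteq> \<zero>\<^bsub>X\<^esub>" using nonzero by auto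
    then have "inj (\<lambda>t. emb (t \<odot>\<^bsub>X\<^esub> x))" by (rule inj_real_multiples[OF universe])
    then show ?thesis
      using that archimedean_real_copy order_dual_eq_if_bounded_into_real_copy[OF vector_lattice_axioms] by blast
  qed
  moreover have "?i" if ?iv
    by (rule isomorphic_c00_if_order_dual_eq[OF that nonzero universe])
  ultimately show ?thesis unfolding Let_def by blast
qed

end
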